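(* (i) Let $F=\{(f_1,g_1),\dots,(f_k,g_k)\}$ be a system of min-plus polynomials in $n$ variables over the semiring $\mathbb{R}$, let $d_i$ be the degree of $(f_i,g_i)$, and let $N=(n+2)(d_1+\dots+d_k)$. Then $F$ has no root in $\mathbb{R}^n$ if and only if there is an algebraic min-plus combination $(f,g)$ of $F$ of degree at most $N$ such that for each monomial $x_1^{\odot j_1}\odot\dots\odot x_n^{\odot j_n}$ occurring in $f$ or in $g$ its coefficient in $f$ is greater than its coefficient in $g$. (ii) There is a fixed polynomial $p$ with the following property. Let $F=\{(f_1,g_1),\dots,(f_k,g_k)\}$ be any system of min-plus polynomials in $n$ variables over the semiring $\mathbb{R}_\infty$, let $d$ be the maximum of the degrees of the $(f_i,g_i)$, and let $N=p(n,k,d)\,(4d)^{\min(n,k)}$. Then $F$ has no root in $\mathbb{R}_\infty^n$ if and only if there is an algebraic min-plus combination $(f,g)$ of $F$ of degree at most $N$ such that for each monomial $x_1^{\odot j_1}\odot\dots\odot x_n^{\odot j_n}$ occurring in $f$ or in $g$ its coefficient in $f$ is greater than its coefficient in $g$, and moreover the constant term of $g$ is finite.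
   Context: $\mathbb{R}_\infty=\mathbb{R}\cup\{+\infty\}$. Tropical operations on $\mathbb{K}\in\{\mathbb{R},\mathbb{R}_\infty\}$: $x\oplus y=\min\{x,y\}$, $x\odot y=x+y$. A tropical monomial is $m(\vec x)=c\odot \vec x^{I}$ with $c\in\mathbb{K}$, $I=(i_1,\dots,i_n)\in\mathbb{Z}_{\ge0}^n$ and $\vec x^{I}=x_1^{\odot i_1}\odot\dots\odot x_n^{\odot i_n}=i_1x_1+\dots+i_nx_n$ in classical notation (with $0\cdot\infty=0$); its degree is $|I|=i_1+\dots+i_n$. A tropical polynomial is a finite tropical sum $f=\min_i m_i$ of monomials with pairwise distinct exponent vectors; its degree is the maximal degree of its monomials. A min-plus polynomial is a pair $(f,g)$ of tropical polynomials; its degree is $\max(\deg f,\deg g)$; $\vec a\in\mathbb{K}^n$ is a root of $(f,g)$ if $f(\vec a)=g(\vec a)$. A root of a system is a common root of all its members. An algebraic min-plus combination of $F$ is a pair $(f,g)=\bigl(\bigoplus_{t=1}^{K}m_t\odot p_t,\ \bigoplus_{t=1}^{K}m_t\odot q_t\bigr)$ with $K\ge1$, where each $m_t$ is a tropical monomial with finite coefficient and each $(p_t,q_t)$ is one of the pairs $(f_i,g_i)$ or $(g_i,f_i)$, $1\le i\le k$. The tropical sums are expanded and, for each exponent vector, the minimum of the coefficients is taken. The coefficient of a monomial $\vec x^J$ absent from a polynomial is taken to be $\infty$; a monomial occurs in a polynomial if its coefficient there is finite. *)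

theory Defs
  imports Complex_Main "HOL-Library.Extended_Real" "HOL-Library.Poly_Mapping" "HOL-Library.FuncSet"
begin

text \<open>
  The semirings \<open>\<real>\<close> and \<open>\<real>\<^sub>\<infinity>\<close> are rendered as subsets of \<^typ>\<open>ereal\<close>, with tropical addition
  \<^const>\<open>min\<close> and tropical multiplication \<open>+\<close>; note that \<open>0 * \<infinity> = 0\<close> holds in \<^typ>\<open>ereal\<close>.
\<close>

definition Rfin :: "ereal set" where
  "Rfin = range ereal"

definition Rinf :: "ereal set" where
  "Rinf = range ereal \<union> {\<infinity>}"

text \<open>
  The variables of a polynomial in \<open>n\<close> variables are indexed by \<open>{..<n}\<close>. A polynomial is
  given by its coefficient function, which is \<open>\<infinity>\<close> at the exponent vectors that are absent.
\<close>

type_synonym expvec = "nat \<Rightarrow>\<^sub>0 nat"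
type_synonym tpoly = "expvec \<Rightarrow> ereal"

definition expvecs :: "nat \<Rightarrow> expvec set" where
  "expvecs n = {I. Poly_Mapping.keys I \<subseteq> {..<n}}"

definition expvec_degree :: "expvec \<Rightarrow> nat" where
  "expvec_degree I = (\<Sum>i\<in>Poly_Mapping.keys I. Poly_Mapping.lookup I i)"

definition monom_eval :: "expvec \<Rightarrow> (nat \<Rightarrow> ereal) \<Rightarrow> ereal" where
  "monom_eval I a = (\<Sum>i\<in>Poly_Mapping.keys I. ereal (real (Poly_Mapping.lookup I i)) * a i)"

text \<open>
  \<open>S\<close> is the set of exponent vectors of the monomials of which \<open>f\<close> is the tropical sum. Over
  \<^const>\<open>Rfin\<close> every such polynomial has a finite coefficient; over \<^const>\<open>Rinf\<close> the polynomial
  that is constantly \<open>\<infinity>\<close> is included.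
\<close>

definition is_tpoly :: "ereal set \<Rightarrow> nat \<Rightarrow> tpoly \<Rightarrow> bool" where
  "is_tpoly K n f \<longleftrightarrow>
     (\<exists>S. finite S \<and> S \<noteq> {} \<and> S \<subseteq> expvecs n \<and> (\<forall>I\<in>S. f I \<in> K) \<and> (\<forall>I. I \<notin> S \<longrightarrow> f I = \<infinity>))"

definition occurring :: "tpoly \<Rightarrow> expvec set" where
  "occurring f = {I. f I \<noteq> \<infinity>}"

text \<open>The polynomial that is constantly \<open>\<infinity>\<close> is a constant, so it gets degree \<open>0\<close>.\<close>

definition tpoly_degree :: "tpoly \<Rightarrow> nat" where
  "tpoly_degree f = Max (insert 0 (expvec_degree ` occurring f))"

definition tpoly_eval :: "tpoly \<Rightarrow> (nat \<Rightarrow> ereal) \<Rightarrow> ereal" where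
  "tpoly_eval f a = (INF I\<in>occurring f. f I + monom_eval I a)"

definition pair_degree :: "tpoly \<times> tpoly \<Rightarrow> nat" where
  "pair_degree P = max (tpoly_degree (fst P)) (tpoly_degree (snd P))"

definition minplus_system :: "ereal set \<Rightarrow> nat \<Rightarrow> (tpoly \<times> tpoly) list \<Rightarrow> bool" where
  "minplus_system K n F \<longleftrightarrow> (\<forall>(f, g)\<in>set F. is_tpoly K n f \<and> is_tpoly K n g)"

definition system_roots :: "ereal set \<Rightarrow> nat \<Rightarrow> (tpoly \<times> tpoly) list \<Rightarrow> (nat \<Rightarrow> ereal) set" where
  "system_roots K n F =
     {a \<in> {..<n} \<rightarrow>\<^sub>E K. \<forall>(f, g)\<in>set F. tpoly_eval f a = tpoly_eval g a}"

text \<open>The coefficients of the product of \<open>p\<close> with the monomial of coefficient \<open>c\<close> and exponent \<open>M\<close>.\<close>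

definition monom_mult :: "real \<Rightarrow> expvec \<Rightarrow> tpoly \<Rightarrow> tpoly" where
  "monom_mult c M p = (\<lambda>I. if \<exists>J. I = M + J then ereal c + p (I - M) else \<infinity>)"

definition tpoly_sum :: "nat \<Rightarrow> (nat \<Rightarrow> tpoly) \<Rightarrow> tpoly" where
  "tpoly_sum K h = (\<lambda>I. INF t\<in>{..<K}. h t I)"

definition alg_combination ::
  "nat \<Rightarrow> (tpoly \<times> tpoly) list \<Rightarrow> tpoly \<times> tpoly \<Rightarrow> bool" where
  "alg_combination n F P \<longleftrightarrow>
     (\<exists>K c M p q. K \<ge> 1 \<and>
        (\<forall>t<K. M t \<in> expvecs n \<and> ((p t, q t) \<in> set F \<or> (q t, p t) \<in> set F)) \<and>
        P = (tpoly_sum K (\<lambda>t. monom_mult (c t) (M t) (p t)),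
             tpoly_sum K (\<lambda>t. monom_mult (c t) (M t) (q t))))"

definition coeffs_greater :: "tpoly \<Rightarrow> tpoly \<Rightarrow> bool" where
  "coeffs_greater f g \<longleftrightarrow> (\<forall>J\<in>occurring f \<union> occurring g. f J > g J)"

definition polynomial3 :: "(real \<Rightarrow> real \<Rightarrow> real \<Rightarrow> real) \<Rightarrow> bool" where
  "polynomial3 p \<longleftrightarrow>
     (\<exists>D C. \<forall>x y z. p x y z = (\<Sum>a\<le>D. \<Sum>b\<le>D. \<Sum>c\<le>D. C a b c * x ^ a * y ^ b * z ^ c))"

end

theory Submission imports Defs begin

text \<open>
  Suppose that \<open>F\<close> has no root. For part (i) let \<open>\<psi> J\<close> be the least cost, in coefficients, of writing
  an exponent vector \<open>J\<close> as a nonnegative real combination of exponent vectors occurring in the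
  pairs, each pair having total weight \<open>n + 2\<close>. By linear programming duality \<open>J\<close> comes with a
  point \<open>a\<close> such that only monomials attaining the minimum of \<open>f\<^sub>i \<oplus> g\<^sub>i\<close> at \<open>a\<close> are used. Some pair
  is separated at \<open>a\<close>, say \<open>p(a) > q(a)\<close>, so it contributes monomials of \<open>q\<close> only, and by
  Caratheodory's theorem one of them, \<open>I\<close>, has weight above \<open>1\<close>. The row of \<open>J\<close> is the product of
  \<open>(p, q)\<close> with \<open>x\<^bsup>J - I\<^esup>\<close>, scaled so that \<open>x\<^sup>J\<close> has the coefficient \<open>\<psi> J\<close> in the second component.
  Its monomials in the first component have coefficients at least \<open>\<psi>\<close>, and where equality holds the
  set of dual optima shrinks strictly; hence a small multiple of a rank function added to \<open>\<psi>\<close> makes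
  all inequalities strict.

  For part (ii) weight may also be left out, and \<open>c\<close> unit vectors may be added per unit of weight
  used, so that \<open>J = 0\<close> is allowed. The dual optimum then provides \<open>a\<close> and a scale \<open>b\<close> with \<open>a\<^sub>j \<ge> -b\<close>
  such that weight is left out only in pairs of value at least \<open>c * b\<close>. If all pairs separated at \<open>a\<close>
  were of this kind, a large coordinate threshold could be chosen by the pigeonhole principle so that
  raising the coordinates above it to \<open>\<infinity>\<close> gives a root; this needs \<open>c\<close> of the order
  \<open>(4 * d) ^ min n k\<close>.
\<close>

section \<open>Linear programming duality\<close>

text \<open>A pair \<open>(a, b)\<close> stands for the inequality
  \<open>(\<Sum>v\<in>V. a v * x v) \<le> b\<close>; the rules produce nonnegative combinations in a
  form that composes along successive eliminations.\<close>

inductive conic :: "(('v \<Rightarrow> real) \<times> real) set \<Rightarrow> ('v \<Rightarrow> real) \<Rightarrow> real \<Rightarrow> bool" for S where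
  base: "(a, b) \<in> S \<Longrightarrow> conic S a b"
| add: "conic S a b \<Longrightarrow> conic S a' b' \<Longrightarrow> conic S (\<lambda>v. a v + a' v) (b + b')"
| scale: "conic S a b \<Longrightarrow> 0 \<le> t \<Longrightarrow> conic S (\<lambda>v. t * a v) (t * b)"

lemma conic_trans:
  assumes "conic S' a b" and "\<And>a b. (a, b) \<in> S' \<Longrightarrow> conic S a b"
  shows "conic S a b"
  using assms(1) by induction (auto intro: assms(2) conic.intros)

lemma conic_coordinate_zero:
  assumes "conic S a b" and "\<And>a b. (a, b) \<in> S \<Longrightarrow> a v = 0"
  shows "a v = 0"
  using assms(1) by induction (auto dest: assms(2))

lemma finite_sets_separated:
  fixes L U :: "real set"
  assumes "finite L" "finite U" "\<forall>l\<in>L. \<forall>u\<in>U. l \<le> u"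
  shows "\<exists>t. (\<forall>l\<in>L. l \<le> t) \<and> (\<forall>u\<in>U. t \<le> u)"
proof (cases "L = {}")
  case True
  then show ?thesis using assms(2) by (intro exI[of _ "Min U"]) auto
next
  case False
  with assms show ?thesis by (intro exI[of _ "Max L"]) auto
qed

text \<open>Fourier--Motzkin elimination, one variable per induction step.\<close>

lemma farkas_conic:
  fixes S :: "(('v \<Rightarrow> real) \<times> real) set"
  assumes "finite V" "finite S" "\<nexists>x. \<forall>(a, b)\<in>S. (\<Sum>v\<in>V. a v * x v) \<le> b"
  shows "\<exists>a b. conic S a b \<and> (\<forall>v\<in>V. a v = 0) \<and> b < 0"
  using assms
proof (induction V arbitrary: S rule: finite_induct)
  case empty
  then show ?case by (force intro: conic.base simp: not_le)
next
  case (insert v V)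
  define Z where "Z = {c \<in> S. fst c v = 0}"
  define P where "P = {c \<in> S. fst c v > 0}"
  define N where "N = {c \<in> S. fst c v < 0}"
  \<comment> \<open>The two multipliers are positive and chosen so that the variable
    \<open>v\<close> cancels.\<close>
  define comb :: "(('v \<Rightarrow> real) \<times> real) \<times> (('v \<Rightarrow> real) \<times> real) \<Rightarrow> (('v \<Rightarrow> real) \<times> real)"
    where "comb = (\<lambda>(c, c'). (\<lambda>w. - fst c' v * fst c w + fst c v * fst c' w,
                        - fst c' v * snd c + fst c v * snd c'))"
  define S' where "S' = Z \<union> comb ` (P \<times> N)"
  have fin: "finite S'" "finite P" "finite N"
    using insert.prems(1) by (auto simp: S'_def Z_def P_def N_def)
  have conic_S': "conic S a b" if "(a, b) \<in> S'" for a b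
  proof (cases "(a, b) \<in> Z")
    case False
    then obtain c c' where c: "c \<in> P" "c' \<in> N" "(a, b) = comb (c, c')"
      using \<open>(a, b) \<in> S'\<close> by (auto simp: S'_def)
    have "conic S (fst c) (snd c)" "conic S (fst c') (snd c')"
      using c by (auto simp: P_def N_def intro: conic.base)
    moreover have "0 \<le> - fst c' v" "0 \<le> fst c v" using c by (auto simp: P_def N_def)
    ultimately have "conic S (\<lambda>w. - fst c' v * fst c w + fst c v * fst c' w)
        (- fst c' v * snd c + fst c v * snd c')"
      by (intro conic.add conic.scale)
    then show ?thesis using c(3) by (simp add: comb_def)
  qed (auto simp: Z_def intro: conic.base)
  have zero_S': "a v = 0" if "(a, b) \<in> S'" for a b
    using that by (auto simp: S'_def Z_def comb_def)
  have "\<nexists>x. \<forall>(a, b)\<in>S'. (\<Sum>v\<in>V. a v * x v) \<le> b"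
  proof
    assume "\<exists>x. \<forall>(a, b)\<in>S'. (\<Sum>v\<in>V. a v * x v) \<le> b"
    then obtain x where x: "\<And>c. c \<in> S' \<Longrightarrow> (\<Sum>v\<in>V. fst c v * x v) \<le> snd c" by fastforce
    define s where "s = (\<lambda>c::('v \<Rightarrow> real) \<times> real. \<Sum>v\<in>V. fst c v * x v)"
    \<comment> \<open>The bound that \<open>c\<close> puts on the coordinate \<open>v\<close> once
      the others are fixed: upper for \<open>P\<close>, lower for \<open>N\<close>. The combined
      inequalities in \<open>S'\<close> say that no lower bound exceeds an upper one.\<close>
    define bd where "bd = (\<lambda>c. (snd c - s c) / fst c v)"
    have sep: "bd c' \<le> bd c" if "c \<in> P" "c' \<in> N" for c c'
    proof -
      have "s (comb (c, c')) = - fst c' v * s c + fst c v * s c'"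
        by (simp add: s_def comb_def sum.distrib sum_distrib_left algebra_simps sum_negf sum_subtractf)
      moreover have "s (comb (c, c')) \<le> snd (comb (c, c'))"
        unfolding s_def using that by (intro x) (auto simp: S'_def)
      ultimately have "- fst c' v * s c + fst c v * s c' \<le> - fst c' v * snd c + fst c v * snd c'"
        by (simp add: comb_def)
      moreover have "fst c v > 0" "fst c' v < 0" using that by (auto simp: P_def N_def)
      ultimately show ?thesis by (simp add: bd_def field_simps)
    qed
    have "\<exists>t. (\<forall>l\<in>bd ` N. l \<le> t) \<and> (\<forall>u\<in>bd ` P. t \<le> u)"
    proof (intro finite_sets_separated ballI)
      show "l \<le> u" if "l \<in> bd ` N" "u \<in> bd ` P" for l u using that sep by blast
    qed (use fin in simp_all)
    then obtain t where t: "\<And>c. c \<in> N \<Longrightarrow> bd c \<le> t" "\<And>c. c \<in> P \<Longrightarrow> t \<le> bd c"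
      by (elim exE conjE) blast
    define x' where "x' = x(v := t)"
    have "(\<Sum>w\<in>insert v V. fst c w * x' w) \<le> snd c" if "c \<in> S" for c
    proof -
      have "(\<Sum>w\<in>V. fst c w * x' w) = s c"
        unfolding s_def using insert.hyps by (intro sum.cong) (auto simp: x'_def)
      then have eq: "(\<Sum>w\<in>insert v V. fst c w * x' w) = fst c v * t + s c"
        using insert.hyps by (simp add: x'_def)
      consider "c \<in> Z" | "c \<in> P" | "c \<in> N"
        using \<open>c \<in> S\<close> linorder_less_linear[of "fst c v" 0] unfolding Z_def P_def N_def by blast
      then show ?thesis
      proof cases
        case 1
        then have "s c \<le> snd c" unfolding s_def by (intro x) (auto simp: S'_def)
        with 1 eq show ?thesis by (simp add: Z_def)
      next
        case 2
        then have "fst c v > 0" by (simp add: P_def)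
        with t(2)[OF 2] eq show ?thesis by (simp add: bd_def field_simps)
      next
        case 3
        then have "fst c v < 0" by (simp add: N_def)
        with t(1)[OF 3] eq show ?thesis by (simp add: bd_def field_simps)
      qed
    qed
    then show False using insert.prems(2) by fastforce
  qed
  from insert.IH[OF fin(1) this] obtain a b
    where ab: "conic S' a b" "\<forall>v\<in>V. a v = 0" "b < 0" by blast
  have "conic S a b" using conic_trans[OF ab(1) conic_S'] .
  moreover have "a v = 0" using conic_coordinate_zero[OF ab(1) zero_S'] .
  ultimately show ?case using ab by blast
qed

lemma conic_image_multipliers:
  assumes "finite C" "conic ((\<lambda>c. (a c, b c)) ` C) \<alpha> \<beta>"
  shows "\<exists>y. (\<forall>c\<in>C. 0 \<le> y c) \<and> \<alpha> = (\<lambda>v. \<Sum>c\<in>C. y c * a c v) \<and> \<beta> = (\<Sum>c\<in>C. y c * b c)"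
  using assms(2)
proof induction
  case (base \<alpha> \<beta>)
  then obtain c where c: "c \<in> C" "\<alpha> = a c" "\<beta> = b c" by auto
  then show ?case
    using assms(1) by (intro exI[of _ "\<lambda>c'. if c' = c then 1 else 0"]) (auto simp: if_distrib[of "\<lambda>z. z * _"] cong: if_cong)
next
  case (add \<alpha> \<beta> \<alpha>' \<beta>')
  then obtain y y' where
    "\<forall>c\<in>C. 0 \<le> y c" "\<alpha> = (\<lambda>v. \<Sum>c\<in>C. y c * a c v)" "\<beta> = (\<Sum>c\<in>C. y c * b c)"
    "\<forall>c\<in>C. 0 \<le> y' c" "\<alpha>' = (\<lambda>v. \<Sum>c\<in>C. y' c * a c v)" "\<beta>' = (\<Sum>c\<in>C. y' c * b c)" by blast
  then show ?case
    by (intro exI[of _ "\<lambda>c. y c + y' c"]) (auto simp: algebra_simps sum.distrib)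
next
  case (scale \<alpha> \<beta> t)
  then obtain y where
    "\<forall>c\<in>C. 0 \<le> y c" "\<alpha> = (\<lambda>v. \<Sum>c\<in>C. y c * a c v)" "\<beta> = (\<Sum>c\<in>C. y c * b c)" by blast
  then show ?case
    using scale by (intro exI[of _ "\<lambda>c. t * y c"]) (auto simp: algebra_simps sum_distrib_left)
qed

lemma farkas:
  fixes a :: "'c \<Rightarrow> 'v \<Rightarrow> real"
  assumes "finite V" "finite C" "\<nexists>x. \<forall>c\<in>C. (\<Sum>v\<in>V. a c v * x v) \<le> b c"
  shows "\<exists>y. (\<forall>c\<in>C. 0 \<le> y c) \<and> (\<forall>v\<in>V. (\<Sum>c\<in>C. y c * a c v) = 0) \<and> (\<Sum>c\<in>C. y c * b c) < 0"
proof -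
  have "\<exists>\<alpha> \<beta>. conic ((\<lambda>c. (a c, b c)) ` C) \<alpha> \<beta> \<and> (\<forall>v\<in>V. \<alpha> v = 0) \<and> \<beta> < 0"
    using assms by (intro farkas_conic) auto
  then obtain \<alpha> \<beta> where *: "conic ((\<lambda>c. (a c, b c)) ` C) \<alpha> \<beta>" "\<forall>v\<in>V. \<alpha> v = 0" "\<beta> < 0"
    by blast
  with conic_image_multipliers[OF assms(2) *(1)] show ?thesis by auto
qed

text \<open>Gaussian elimination: an unknown with a nonzero entry in the row \<open>\<rho>\<close>
  is solved for and substituted in the other rows, which leaves one unknown and one equation
  fewer.\<close>

lemma homogeneous_system_solution:
  fixes A :: "'e \<Rightarrow> 'r \<Rightarrow> real"
  assumes "finite R" "finite B" "card R < card B"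
  shows "\<exists>\<gamma>. (\<exists>e\<in>B. \<gamma> e \<noteq> 0) \<and> (\<forall>\<rho>\<in>R. (\<Sum>e\<in>B. \<gamma> e * A e \<rho>) = 0)"
  using assms
proof (induction R arbitrary: B A rule: finite_induct)
  case empty
  then have "B \<noteq> {}" by auto
  then show ?case by (intro exI[of _ "\<lambda>_. 1"]) auto
next
  case (insert \<rho> R)
  show ?case
  proof (cases "\<forall>e\<in>B. A e \<rho> = 0")
    case True
    then show ?thesis using insert by fastforce
  next
    case False
    then obtain e0 where e0: "e0 \<in> B" "A e0 \<rho> \<noteq> 0" by blast
    define B' where "B' = B - {e0}"
    have B': "finite B'" "card R < card B'" "B = insert e0 B'" "e0 \<notin> B'"
      using insert.prems insert.hyps e0(1) by (auto simp: B'_def)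
    from insert.IH[OF B'(1,2), of "\<lambda>e \<sigma>. A e \<sigma> - A e \<rho> / A e0 \<rho> * A e0 \<sigma>"]
    obtain \<gamma> where \<gamma>: "\<exists>e\<in>B'. \<gamma> e \<noteq> 0"
      "\<forall>\<sigma>\<in>R. (\<Sum>e\<in>B'. \<gamma> e * (A e \<sigma> - A e \<rho> / A e0 \<rho> * A e0 \<sigma>)) = 0" by blast
    define g where "g = (\<Sum>e\<in>B'. \<gamma> e * A e \<rho>) / A e0 \<rho>"
    define \<gamma>' where "\<gamma>' = \<gamma>(e0 := - g)"
    have sum_eq: "(\<Sum>e\<in>B. \<gamma>' e * A e \<sigma>) = (\<Sum>e\<in>B'. \<gamma> e * A e \<sigma>) - g * A e0 \<sigma>" for \<sigma>
    proof -
      have "(\<Sum>e\<in>B'. \<gamma>' e * A e \<sigma>) = (\<Sum>e\<in>B'. \<gamma> e * A e \<sigma>)"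
        using B'(4) by (intro sum.cong) (auto simp: \<gamma>'_def)
      then show ?thesis using B'(1,4) by (simp add: B'(3) \<gamma>'_def)
    qed
    have "(\<Sum>e\<in>B. \<gamma>' e * A e \<sigma>) = 0" if "\<sigma> \<in> R" for \<sigma>
    proof -
      have "(\<Sum>e\<in>B'. \<gamma> e * (A e \<sigma> - A e \<rho> / A e0 \<rho> * A e0 \<sigma>))
          = (\<Sum>e\<in>B'. \<gamma> e * A e \<sigma>) - g * A e0 \<sigma>"
        by (simp add: g_def algebra_simps sum_subtractf sum_distrib_left sum_divide_distrib)
      with \<gamma>(2) that sum_eq show ?thesis by simp
    qed
    moreover have "(\<Sum>e\<in>B. \<gamma>' e * A e \<rho>) = 0" using e0(2) by (simp add: sum_eq g_def)
    moreover have "\<exists>e\<in>B. \<gamma>' e \<noteq> 0" using \<gamma>(1) B'(3,4) by (auto simp: \<gamma>'_def)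
    ultimately show ?thesis by blast
  qed
qed

section \<open>Duality, basic solutions and exchange of columns\<close>

locale linear_program =
  fixes E :: "'e set" and R :: "'r set" and A :: "'e \<Rightarrow> 'r \<Rightarrow> real" and w :: "'e \<Rightarrow> real"
  assumes finite_E: "finite E" and finite_R: "finite R"
begin

definition primal :: "('r \<Rightarrow> real) \<Rightarrow> ('e \<Rightarrow> real) \<Rightarrow> bool" where
  "primal r x \<longleftrightarrow> (\<forall>e\<in>E. 0 \<le> x e) \<and> (\<forall>\<rho>\<in>R. (\<Sum>e\<in>E. x e * A e \<rho>) = r \<rho>)"

definition dual :: "('r \<Rightarrow> real) \<Rightarrow> bool" where
  "dual u \<longleftrightarrow> (\<forall>e\<in>E. (\<Sum>\<rho>\<in>R. u \<rho> * A e \<rho>) \<le> w e)"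

definition optimal :: "('r \<Rightarrow> real) \<Rightarrow> ('e \<Rightarrow> real) \<Rightarrow> ('r \<Rightarrow> real) \<Rightarrow> bool" where
  "optimal r x u \<longleftrightarrow> primal r x \<and> dual u \<and> (\<Sum>e\<in>E. x e * w e) = (\<Sum>\<rho>\<in>R. u \<rho> * r \<rho>)"

lemma primal_pairing:
  assumes "\<forall>\<rho>\<in>R. (\<Sum>e\<in>E. x e * A e \<rho>) = r \<rho>"
  shows "(\<Sum>\<rho>\<in>R. u \<rho> * r \<rho>) = (\<Sum>e\<in>E. x e * (\<Sum>\<rho>\<in>R. u \<rho> * A e \<rho>))"
proof -
  have "(\<Sum>\<rho>\<in>R. u \<rho> * r \<rho>) = (\<Sum>\<rho>\<in>R. \<Sum>e\<in>E. u \<rho> * (x e * A e \<rho>))"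
    using assms by (intro sum.cong) (auto simp: sum_distrib_left[symmetric])
  also have "\<dots> = (\<Sum>e\<in>E. \<Sum>\<rho>\<in>R. u \<rho> * (x e * A e \<rho>))" by (rule sum.swap)
  finally show ?thesis by (simp add: sum_distrib_left mult_ac)
qed

lemma weak_duality:
  assumes "primal r x" "dual u"
  shows "(\<Sum>\<rho>\<in>R. u \<rho> * r \<rho>) \<le> (\<Sum>e\<in>E. x e * w e)"
proof -
  have "(\<Sum>\<rho>\<in>R. u \<rho> * r \<rho>) = (\<Sum>e\<in>E. x e * (\<Sum>\<rho>\<in>R. u \<rho> * A e \<rho>))"
    using assms(1) by (intro primal_pairing) (auto simp: primal_def)
  also have "\<dots> \<le> (\<Sum>e\<in>E. x e * w e)"
    using assms by (intro sum_mono mult_left_mono) (auto simp: primal_def dual_def)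
  finally show ?thesis .
qed

text \<open>The duality gap is the sum of the nonnegative terms
  \<open>x e * (w e - (\<Sum>\<rho>\<in>R. u \<rho> * A e \<rho>))\<close>, so it vanishes exactly
  when each of them does.\<close>

lemma optimal_iff_slackness:
  assumes "primal r x" "dual u"
  shows "optimal r x u \<longleftrightarrow> (\<forall>e\<in>E. x e > 0 \<longrightarrow> (\<Sum>\<rho>\<in>R. u \<rho> * A e \<rho>) = w e)"
proof -
  have "(\<Sum>e\<in>E. x e * w e) - (\<Sum>\<rho>\<in>R. u \<rho> * r \<rho>) = (\<Sum>e\<in>E. x e * (w e - (\<Sum>\<rho>\<in>R. u \<rho> * A e \<rho>)))"
    using assms(1) by (subst primal_pairing[of x])
      (auto simp: primal_def right_diff_distrib sum_subtractf)
  moreover have nonneg: "0 \<le> x e * (w e - (\<Sum>\<rho>\<in>R. u \<rho> * A e \<rho>))" if "e \<in> E" for e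
    using assms that by (auto simp: primal_def dual_def)
  ultimately have "optimal r x u \<longleftrightarrow> (\<forall>e\<in>E. x e * (w e - (\<Sum>\<rho>\<in>R. u \<rho> * A e \<rho>)) = 0)"
    using assms sum_nonneg_eq_0_iff[OF finite_E nonneg] by (auto simp: optimal_def)
  moreover have "\<forall>e\<in>E. 0 \<le> x e" using assms(1) by (simp add: primal_def)
  ultimately show ?thesis by (fastforce simp: less_le)
qed

text \<open>Primal feasibility, dual feasibility and the reverse of weak duality form one linear
  system in \<open>x\<close> and \<open>u\<close>. Were it unsolvable, its Farkas multipliers would
  contradict weak duality or the existence of \<open>x0\<close> and \<open>u0\<close>.\<close>

lemma strong_duality:
  assumes "primal r x0" "dual u0"
  shows "\<exists>x u. optimal r x u"
proof (rule ccontr)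
  assume no_opt: "\<nexists>x u. optimal r x u"
  \<comment> \<open>The blocks of constraints in order: \<open>x \<ge> 0\<close>, the two halves of
    the primal equations, the dual inequalities, the comparison of the two values.\<close>
  define a :: "'e + 'r + 'r + 'e + unit \<Rightarrow> 'e + 'r \<Rightarrow> real" where
    "a = case_sum (\<lambda>e. case_sum (\<lambda>e'. if e = e' then - 1 else 0) (\<lambda>_. 0))
        (case_sum (\<lambda>\<rho>. case_sum (\<lambda>e. A e \<rho>) (\<lambda>_. 0))
        (case_sum (\<lambda>\<rho>. case_sum (\<lambda>e. - A e \<rho>) (\<lambda>_. 0))
        (case_sum (\<lambda>e. case_sum (\<lambda>_. 0) (\<lambda>\<rho>. A e \<rho>))
        (\<lambda>_. case_sum w (\<lambda>\<rho>. - r \<rho>)))))"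
  define b :: "'e + 'r + 'r + 'e + unit \<Rightarrow> real" where
    "b = case_sum (\<lambda>_. 0) (case_sum r (case_sum (\<lambda>\<rho>. - r \<rho>) (case_sum w (\<lambda>_. 0))))"
  define C where "C = E <+> (R <+> (R <+> (E <+> {()})))"
  have "\<nexists>x. \<forall>c\<in>C. (\<Sum>v\<in>E <+> R. a c v * x v) \<le> b c"
  proof
    assume "\<exists>x. \<forall>c\<in>C. (\<Sum>v\<in>E <+> R. a c v * x v) \<le> b c"
    then obtain z where z: "\<forall>c\<in>C. (\<Sum>v\<in>E <+> R. a c v * z v) \<le> b c" by blast
    define x where "x = z \<circ> Inl"
    define u where "u = z \<circ> Inr"
    have z': "(\<Sum>e\<in>E. a c (Inl e) * x e) + (\<Sum>\<rho>\<in>R. a c (Inr \<rho>) * u \<rho>) \<le> b c" if "c \<in> C" for c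
      using z that by (simp add: sum.Plus finite_E finite_R x_def u_def comp_def)
    have "0 \<le> x e" if "e \<in> E" for e
    proof -
      have "(\<Sum>e'\<in>E. (if e = e' then - 1 else 0) * x e') = - x e"
        using finite_E that by (simp add: if_distrib[of "\<lambda>z. z * _"] cong: if_cong)
      with z'[of "Inl e"] that show ?thesis by (auto simp: C_def a_def b_def)
    qed
    moreover have "(\<Sum>e\<in>E. x e * A e \<rho>) = r \<rho>" if "\<rho> \<in> R" for \<rho>
      using z'[of "Inr (Inl \<rho>)"] z'[of "Inr (Inr (Inl \<rho>))"] that
      by (auto simp: C_def a_def b_def sum_negf mult.commute intro!: antisym)
    ultimately have "primal r x" by (simp add: primal_def)
    moreover have "dual u"
      using z'[of "Inr (Inr (Inr (Inl e)))" for e]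
      by (auto simp: dual_def C_def a_def b_def mult.commute)
    moreover have "(\<Sum>e\<in>E. x e * w e) \<le> (\<Sum>\<rho>\<in>R. u \<rho> * r \<rho>)"
      using z'[of "Inr (Inr (Inr (Inr ())))"]
      by (auto simp: C_def a_def b_def sum_negf mult.commute)
    ultimately have "optimal r x u" using weak_duality[of r x u] by (simp add: optimal_def)
    with no_opt show False by blast
  qed
  moreover have "finite C" "finite (E <+> R)" by (auto simp: C_def finite_E finite_R)
  ultimately obtain y where y: "\<forall>c\<in>C. 0 \<le> y c" "\<forall>v\<in>E <+> R. (\<Sum>c\<in>C. y c * a c v) = 0"
      "(\<Sum>c\<in>C. y c * b c) < 0"
    using farkas[of "E <+> R" C a b] by blast
  \<comment> \<open>The multipliers by block. Those of the two halves of the equations merge into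
    one signed vector \<open>l\<close>; up to the factor \<open>t\<close>, \<open>l\<close> is a
    dual vector and \<open>z\<close> a primal one.\<close>
  define s where "s = (\<lambda>e. y (Inl e))"
  define l where "l = (\<lambda>\<rho>. y (Inr (Inr (Inl \<rho>))) - y (Inr (Inl \<rho>)))"
  define z where "z = (\<lambda>e. y (Inr (Inr (Inr (Inl e)))))"
  define t where "t = y (Inr (Inr (Inr (Inr ()))))"
  have nonneg: "0 \<le> t" "\<And>e. e \<in> E \<Longrightarrow> 0 \<le> s e" "\<And>e. e \<in> E \<Longrightarrow> 0 \<le> z e"
    using y(1) by (auto simp: C_def s_def z_def t_def)
  have sum_C: "(\<Sum>c\<in>C. h c) = (\<Sum>e\<in>E. h (Inl e)) + ((\<Sum>\<rho>\<in>R. h (Inr (Inl \<rho>)))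
      + ((\<Sum>\<rho>\<in>R. h (Inr (Inr (Inl \<rho>)))) + ((\<Sum>e\<in>E. h (Inr (Inr (Inr (Inl e)))))
      + h (Inr (Inr (Inr (Inr ())))))))" for h :: "_ \<Rightarrow> real"
    by (simp add: C_def sum.Plus finite_E finite_R comp_def)
  have row_x: "(\<Sum>\<rho>\<in>R. l \<rho> * A e \<rho>) \<le> t * w e" if "e \<in> E" for e
  proof -
    have "(\<Sum>e'\<in>E. y (Inl e') * (if e' = e then - 1 else 0)) = - s e"
      using finite_E that by (simp add: if_distrib[of "\<lambda>z. _ * z"] s_def cong: if_cong)
    moreover have "(\<Sum>c\<in>C. y c * a c (Inl e)) = 0" using y(2) that by auto
    ultimately have "- s e - (\<Sum>\<rho>\<in>R. l \<rho> * A e \<rho>) + t * w e = 0"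
      by (simp add: sum_C a_def l_def t_def algebra_simps sum_subtractf sum_negf)
    with nonneg(2)[OF that] show ?thesis by linarith
  qed
  have row_u: "(\<Sum>e\<in>E. z e * A e \<rho>) = t * r \<rho>" if "\<rho> \<in> R" for \<rho>
  proof -
    have "(\<Sum>c\<in>C. y c * a c (Inr \<rho>)) = 0" using y(2) that by auto
    then show ?thesis by (simp add: sum_C a_def z_def t_def)
  qed
  have neg: "(\<Sum>e\<in>E. z e * w e) < (\<Sum>\<rho>\<in>R. l \<rho> * r \<rho>)"
    using y(3) by (simp add: sum_C b_def l_def z_def algebra_simps sum_subtractf sum_negf)
  show False
  proof (cases "t = 0")
    case True
    \<comment> \<open>With \<open>t = 0\<close> the vectors \<open>l\<close> and \<open>z\<close>
      are mere directions; pairing them with \<open>x0\<close> and \<open>u0\<close> gives signs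
      incompatible with \<open>neg\<close>.\<close>
    have "(\<Sum>\<rho>\<in>R. l \<rho> * r \<rho>) = (\<Sum>e\<in>E. x0 e * (\<Sum>\<rho>\<in>R. l \<rho> * A e \<rho>))"
      using assms(1) by (intro primal_pairing) (auto simp: primal_def)
    also have "\<dots> \<le> 0"
      using row_x True assms(1) by (intro sum_nonpos) (auto simp: primal_def mult_nonneg_nonpos)
    finally have "(\<Sum>\<rho>\<in>R. l \<rho> * r \<rho>) \<le> 0" .
    moreover have "0 = (\<Sum>e\<in>E. z e * (\<Sum>\<rho>\<in>R. u0 \<rho> * A e \<rho>))"
      using primal_pairing[of z "\<lambda>_. 0" u0] row_u True by simp
    moreover have "\<dots> \<le> (\<Sum>e\<in>E. z e * w e)"
      using assms(2) nonneg(3) by (intro sum_mono mult_left_mono) (auto simp: dual_def)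
    ultimately show False using neg by linarith
  next
    case False
    with nonneg have t: "t > 0" by simp
    have "primal r (\<lambda>e. z e / t)"
      using row_u nonneg t by (auto simp: primal_def sum_divide_distrib[symmetric])
    moreover have "dual (\<lambda>\<rho>. l \<rho> / t)"
      using row_x t by (auto simp: dual_def sum_divide_distrib[symmetric] divide_le_eq mult.commute)
    ultimately have "(\<Sum>\<rho>\<in>R. l \<rho> / t * r \<rho>) \<le> (\<Sum>e\<in>E. z e / t * w e)" by (rule weak_duality)
    then have "(\<Sum>\<rho>\<in>R. l \<rho> * r \<rho>) / t \<le> (\<Sum>e\<in>E. z e * w e) / t"
      by (simp add: sum_divide_distrib)
    with neg t show False by (simp add: divide_le_cancel)
  qed
qed

text \<open>Among the vectors optimal together with \<open>u\<close>, one of least support is taken.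
  A linear relation between its columns would allow a move that empties one of them, and
  complementary slackness with the same \<open>u\<close> keeps the result optimal.\<close>

lemma basic_optimal:
  assumes "optimal r x0 u"
  obtains x where "optimal r x u"
    "\<And>\<gamma> e. (\<forall>\<rho>\<in>R. (\<Sum>e\<in>{e\<in>E. x e > 0}. \<gamma> e * A e \<rho>) = 0) \<Longrightarrow> e \<in> E \<Longrightarrow> x e > 0 \<Longrightarrow> \<gamma> e = 0"
proof -
  define supp where "supp = (\<lambda>x::'e \<Rightarrow> real. {e\<in>E. x e > 0})"
  obtain x where x: "optimal r x u" and least: "\<And>x'. optimal r x' u \<Longrightarrow> card (supp x) \<le> card (supp x')"
    using ex_has_least_nat[of "\<lambda>x. optimal r x u" x0 "\<lambda>x. card (supp x)"] assms by blast
  have px: "primal r x" and du: "dual u" using x by (auto simp: optimal_def)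
  have no_positive: "\<gamma> e \<le> 0"
    if \<gamma>: "\<forall>\<rho>\<in>R. (\<Sum>e\<in>supp x. \<gamma> e * A e \<rho>) = 0" and e: "e \<in> supp x" for \<gamma> e
  proof (rule ccontr)
    assume "\<not> \<gamma> e \<le> 0"
    define P where "P = {e \<in> supp x. \<gamma> e > 0}"
    have P: "finite P" "P \<noteq> {}" using e \<open>\<not> \<gamma> e \<le> 0\<close> finite_E by (auto simp: P_def supp_def)
    \<comment> \<open>Ratio test: the largest step along \<open>- \<gamma>\<close> that keeps all
      weights nonnegative. At the minimizing column \<open>e1\<close> the weight drops to
      \<open>0\<close>.\<close>
    define t where "t = Min ((\<lambda>e. x e / \<gamma> e) ` P)"
    have "t \<in> (\<lambda>e. x e / \<gamma> e) ` P" unfolding t_def using P by (intro Min_in) auto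
    then obtain e1 where e1: "e1 \<in> P" "t = x e1 / \<gamma> e1" by auto
    have t_le: "t * \<gamma> e \<le> x e" if "e \<in> P" for e
    proof -
      have "t \<le> x e / \<gamma> e" using that P by (simp add: t_def)
      with that show ?thesis by (simp add: P_def field_simps)
    qed
    have t0: "t > 0" using e1 by (auto simp: P_def supp_def)
    define x' where "x' = (\<lambda>e. if e \<in> supp x then x e - t * \<gamma> e else x e)"
    have "0 \<le> x' e" if "e \<in> E" for e
    proof (cases "e \<in> P")
      case False
      have "0 \<le> x e" using px that by (simp add: primal_def)
      moreover have "e \<in> supp x \<Longrightarrow> t * \<gamma> e \<le> 0"
        using False t0 by (auto simp: P_def not_less intro: mult_nonneg_nonpos)
      ultimately show ?thesis by (auto simp: x'_def)
    qed (use t_le in \<open>auto simp: x'_def P_def\<close>)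
    moreover have "(\<Sum>e\<in>E. x' e * A e \<rho>) = r \<rho>" if "\<rho> \<in> R" for \<rho>
    proof -
      have "(\<Sum>e\<in>E. x' e * A e \<rho>) = (\<Sum>e\<in>E. x e * A e \<rho> - (if e \<in> supp x then t * \<gamma> e * A e \<rho> else 0))"
        by (intro sum.cong) (auto simp: x'_def algebra_simps)
      also have "\<dots> = r \<rho> - (\<Sum>e\<in>supp x. t * \<gamma> e * A e \<rho>)"
        using px that finite_E
        by (auto simp: primal_def sum_subtractf supp_def simp flip: sum.inter_filter)
      also have "(\<Sum>e\<in>supp x. t * \<gamma> e * A e \<rho>) = t * (\<Sum>e\<in>supp x. \<gamma> e * A e \<rho>)"
        by (simp add: sum_distrib_left mult.assoc)
      finally show ?thesis using \<gamma> that by simp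
    qed
    ultimately have px': "primal r x'" by (simp add: primal_def)
    have sub: "supp x' \<subseteq> supp x - {e1}"
      using e1 by (auto simp: supp_def x'_def P_def)
    then have "optimal r x' u"
      using x px px' du by (auto simp: optimal_iff_slackness supp_def)
    then have "card (supp x) \<le> card (supp x')" by (rule least)
    moreover have "card (supp x') < card (supp x)"
      using sub e1(1) finite_E by (intro psubset_card_mono) (auto simp: supp_def P_def)
    ultimately show False by simp
  qed
  have "\<gamma> e = 0" if "\<forall>\<rho>\<in>R. (\<Sum>e\<in>supp x. \<gamma> e * A e \<rho>) = 0" "e \<in> supp x" for \<gamma> e
    using no_positive[OF that] no_positive[of "\<lambda>e. - \<gamma> e" e] that by (simp add: sum_negf)
  then show ?thesis using x by (intro that[of x]) (auto simp: supp_def)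
qed

lemma primal_exchange:
  assumes "primal r x" "e \<in> E" "e' \<in> E" "1 \<le> x e" "\<And>\<rho>. \<rho> \<in> R \<Longrightarrow> r' \<rho> = r \<rho> - A e \<rho> + A e' \<rho>"
  defines "x' \<equiv> \<lambda>f. x f - (if f = e then 1 else 0) + (if f = e' then 1 else 0)"
  shows "primal r' x'" "(\<Sum>f\<in>E. x' f * w f) = (\<Sum>f\<in>E. x f * w f) - w e + w e'"
proof -
  have eq: "(\<Sum>f\<in>E. x' f * h f) = (\<Sum>f\<in>E. x f * h f) - h e + h e'" for h
  proof -
    have "(\<Sum>f\<in>E. x' f * h f)
        = (\<Sum>f\<in>E. x f * h f - (if f = e then h f else 0) + (if f = e' then h f else 0))"
      by (intro sum.cong) (auto simp: x'_def algebra_simps)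
    then show ?thesis using assms finite_E by (simp add: sum.distrib sum_subtractf)
  qed
  show "(\<Sum>f\<in>E. x' f * w f) = (\<Sum>f\<in>E. x f * w f) - w e + w e'" by (rule eq)
  have "0 \<le> x' f" if "f \<in> E" for f using assms(1,4) that by (auto simp: primal_def x'_def)
  then show "primal r' x'" using assms(1,5) by (auto simp: primal_def eq)
qed

text \<open>
  Exchanging one unit of a column \<open>e\<close> of weight above \<open>1\<close> keeps the support of \<open>x\<close>. If this is
  still optimal, then every dual optimum of the new right-hand side is one of the old, whereas
  \<open>u\<close> is lost because it is not tight at \<open>e'\<close>.
\<close>

lemma optimal_exchange:
  assumes opt: "optimal r x u" and opt': "optimal r' x' u'"
    and e: "e \<in> E" "e' \<in> E" "1 < x e" "(\<Sum>\<rho>\<in>R. u \<rho> * A e' \<rho>) < w e'"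
    and r': "\<And>\<rho>. \<rho> \<in> R \<Longrightarrow> r' \<rho> = r \<rho> - A e \<rho> + A e' \<rho>"
  shows "(\<Sum>f\<in>E. x' f * w f) \<le> (\<Sum>f\<in>E. x f * w f) - w e + w e'"
    and "(\<Sum>f\<in>E. x' f * w f) = (\<Sum>f\<in>E. x f * w f) - w e + w e' \<Longrightarrow>
      {v. \<exists>z. optimal r' z v} \<subset> {v. \<exists>z. optimal r z v}"
proof -
  define z where "z = (\<lambda>f. x f - (if f = e then 1 else 0) + (if f = e' then 1 else (0::real)))"
  have px: "primal r x" and px': "primal r' x'" and du: "dual u" and du': "dual u'"
    and vx': "(\<Sum>f\<in>E. x' f * w f) = (\<Sum>\<rho>\<in>R. u' \<rho> * r' \<rho>)"
    using opt opt' by (auto simp: optimal_def)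
  have pz: "primal r' z" and vz: "(\<Sum>f\<in>E. z f * w f) = (\<Sum>f\<in>E. x f * w f) - w e + w e'"
    using primal_exchange[OF px e(1,2) _ r'] e(3) by (auto simp: z_def)
  show "(\<Sum>f\<in>E. x' f * w f) \<le> (\<Sum>f\<in>E. x f * w f) - w e + w e'"
    using weak_duality[OF pz du'] vz vx' by simp
  assume eq: "(\<Sum>f\<in>E. x' f * w f) = (\<Sum>f\<in>E. x f * w f) - w e + w e'"
  have nonneg: "\<forall>f\<in>E. 0 \<le> x f" using px by (simp add: primal_def)
  \<comment> \<open>By the assumed equality \<open>z\<close> attains the optimal value for
    \<open>r'\<close>, so it is optimal together with every dual optimum of
    \<open>r'\<close>.\<close>
  have z_opt: "optimal r' z v" if "optimal r' y v" for y v
  proof -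
    have "dual v" "(\<Sum>\<rho>\<in>R. v \<rho> * r' \<rho>) = (\<Sum>f\<in>E. y f * w f)" "primal r' y"
      using that by (auto simp: optimal_def)
    moreover from this have "(\<Sum>f\<in>E. y f * w f) = (\<Sum>f\<in>E. x' f * w f)"
      using weak_duality[of r' y u'] weak_duality[of r' x' v] vx' du' px' by simp
    ultimately show ?thesis using pz vz eq by (simp add: optimal_def)
  qed
  have "optimal r x v" if "optimal r' y v" for y v
  proof -
    have dv: "dual v" using that by (simp add: optimal_def)
    have "(\<Sum>\<rho>\<in>R. v \<rho> * A f \<rho>) = w f" if "f \<in> E" "x f > 0" for f
    proof -
      have "z f > 0" using that e(3) by (auto simp: z_def)
      then show ?thesis
        using z_opt[OF \<open>optimal r' y v\<close>] optimal_iff_slackness[OF pz dv] that by blast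
    qed
    then show ?thesis using optimal_iff_slackness[OF px dv] by blast
  qed
  moreover have "\<not> optimal r' y u" for y
  proof
    assume "optimal r' y u"
    then have "optimal r' z u" by (rule z_opt)
    moreover have "z e' > 0" using nonneg e by (auto simp: z_def add_nonneg_pos)
    ultimately show False using optimal_iff_slackness[OF pz du] e by auto
  qed
  ultimately show "{v. \<exists>z. optimal r' z v} \<subset> {v. \<exists>z. optimal r z v}" using opt by blast
qed

end

text \<open>A small multiple of a rank that drops along every tie is added to \<open>\<psi>\<close>;
  the finitely many inequalities that are already strict survive a small perturbation.\<close>

lemma strict_potential:
  fixes \<psi> :: "'s \<Rightarrow> real" and D :: "'s \<Rightarrow> 'd set"
  assumes "finite T" "finite G"
    and G: "\<And>s s' g. (s, s', g) \<in> G \<Longrightarrow>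
      s' \<in> T \<and> \<psi> s' \<le> \<psi> s + g \<and> (\<psi> s' = \<psi> s + g \<longrightarrow> D s' \<subset> D s)"
  shows "\<exists>\<theta>. \<forall>(s, s', g)\<in>G. \<theta> s' < \<theta> s + g"
proof -
  \<comment> \<open>The sets \<open>D s\<close> may be infinite, so the rank counts elements of the
    finite set \<open>T\<close> instead of points of \<open>D s\<close>.\<close>
  define rank where "rank = (\<lambda>s. real (card {t\<in>T. D t \<subset> D s}))"
  have rank_less: "rank s' < rank s" if "s' \<in> T" "D s' \<subset> D s" for s s'
  proof -
    have "{t\<in>T. D t \<subset> D s'} \<subset> {t\<in>T. D t \<subset> D s}" using that by blast
    then show ?thesis using assms(1) by (simp add: rank_def psubset_card_mono)
  qed
  have "\<forall>\<^sub>F \<delta> in at_right 0. \<psi> s' + \<delta> * rank s' < \<psi> s + \<delta> * rank s + g" if "(s, s', g) \<in> G" for s s' g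
  proof (cases "\<psi> s' = \<psi> s + g")
    case True
    then have "rank s' < rank s" using G[OF that] rank_less by blast
    then have "\<psi> s' + \<delta> * rank s' < \<psi> s + \<delta> * rank s + g" if "\<delta> > 0" for \<delta> using True that by simp
    moreover have "\<forall>\<^sub>F \<delta> in at_right 0. \<delta> > (0::real)" by (rule eventually_at_right_less)
    ultimately show ?thesis by (rule eventually_mono[rotated])
  next
    case False
    have "((\<lambda>\<delta>. \<psi> s' + \<delta> * rank s' - (\<psi> s + \<delta> * rank s + g)) \<longlongrightarrow>
        \<psi> s' + 0 * rank s' - (\<psi> s + 0 * rank s + g)) (at_right 0)" by (intro tendsto_intros)
    moreover have "\<psi> s' + 0 * rank s' - (\<psi> s + 0 * rank s + g) < 0" using G[OF that] False by simp
    ultimately have "\<forall>\<^sub>F \<delta> in at_right 0. \<psi> s' + \<delta> * rank s' - (\<psi> s + \<delta> * rank s + g) < 0"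
      by (rule order_tendstoD(2))
    then show ?thesis by simp
  qed
  then have "\<forall>\<^sub>F \<delta> in at_right 0. \<forall>(s, s', g)\<in>G. \<psi> s' + \<delta> * rank s' < \<psi> s + \<delta> * rank s + g"
    by (intro eventually_ball_finite assms(2)) auto
  then obtain \<delta> where "\<forall>(s, s', g)\<in>G. \<psi> s' + \<delta> * rank s' < \<psi> s + \<delta> * rank s + g"
    using eventually_happens'[OF trivial_limit_at_right_real] by blast
  then show ?thesis by (intro exI[of _ "\<lambda>s. \<psi> s + \<delta> * rank s"]) auto
qed

section \<open>The linear program of a min-plus system\<close>

lemma lookup_outside_expvecs: "I \<in> expvecs n \<Longrightarrow> j \<notin> {..<n} \<Longrightarrow> Poly_Mapping.lookup I j = 0"
  by (auto simp: expvecs_def in_keys_iff)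

lemma expvecs_add_iff: "I + J \<in> expvecs n \<longleftrightarrow> I \<in> expvecs n \<and> J \<in> expvecs n"
  by (auto simp: expvecs_def in_keys_iff lookup_add subset_iff)

lemma expvec_degree_eq: "I \<in> expvecs n \<Longrightarrow> expvec_degree I = (\<Sum>j<n. Poly_Mapping.lookup I j)"
  unfolding expvec_degree_def
  by (intro sum.mono_neutral_left) (auto simp: expvecs_def in_keys_iff)

lemma finite_bounded_expvecs: "finite {I \<in> expvecs n. expvec_degree I \<le> N}"
proof -
  let ?S = "{I \<in> expvecs n. expvec_degree I \<le> N}"
  have "Poly_Mapping.lookup I j \<le> N" if "I \<in> ?S" "j < n" for I j
  proof -
    have "Poly_Mapping.lookup I j \<le> (\<Sum>j<n. Poly_Mapping.lookup I j)"
      using that by (intro member_le_sum) auto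
    with that show ?thesis by (auto simp: expvec_degree_eq)
  qed
  then have "Poly_Mapping.lookup ` ?S \<subseteq>
      {g. \<forall>j. (j \<in> {..<n} \<longrightarrow> g j \<in> {..N}) \<and> (j \<notin> {..<n} \<longrightarrow> g j = 0)}"
    by (auto simp: lookup_outside_expvecs)
  then have "finite (Poly_Mapping.lookup ` ?S)"
    by (rule finite_subset) (intro finite_set_of_finite_funs, auto)
  then show ?thesis
    by (rule finite_imageD) (auto simp: inj_on_def Poly_Mapping.lookup_inject)
qed

lemma is_tpoly_mono: "is_tpoly K n f \<Longrightarrow> K \<subseteq> K' \<Longrightarrow> is_tpoly K' n f"
  unfolding is_tpoly_def by blast

lemma minplus_system_Rinf: "minplus_system Rfin n F \<Longrightarrow> minplus_system Rinf n F"
  unfolding minplus_system_def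
  by (auto simp: Rfin_def Rinf_def intro: is_tpoly_mono dest!: bspec)

lemma
  assumes "is_tpoly Rinf n f"
  shows tpoly_occurring_expvecs: "occurring f \<subseteq> expvecs n"
    and tpoly_finite_occurring: "finite (occurring f)"
    and tpoly_coeff: "I \<in> occurring f \<Longrightarrow> f I = ereal (real_of_ereal (f I))"
proof -
  obtain S where S: "finite S" "S \<subseteq> expvecs n" "\<forall>I\<in>S. f I \<in> Rinf" "\<forall>I. I \<notin> S \<longrightarrow> f I = \<infinity>"
    using assms by (auto simp: is_tpoly_def)
  then have "occurring f \<subseteq> S" by (auto simp: occurring_def)
  with S show "occurring f \<subseteq> expvecs n" "finite (occurring f)" by (auto intro: finite_subset)
  show "f I = ereal (real_of_ereal (f I))" if "I \<in> occurring f"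
  proof -
    have "f I \<in> Rinf" "f I \<noteq> \<infinity>"
      using that S(3) \<open>occurring f \<subseteq> S\<close> by (auto simp: occurring_def)
    then show ?thesis by (cases "f I") (auto simp: Rinf_def)
  qed
qed

text \<open>The value of a monomial at a finite point in real arithmetic. It is meaningful for
  occurring \<open>I\<close> only, since \<open>real_of_ereal\<close> sends
  \<open>\<infinity>\<close> to \<open>0\<close>.\<close>

definition mval :: "nat \<Rightarrow> tpoly \<Rightarrow> (nat \<Rightarrow> real) \<Rightarrow> expvec \<Rightarrow> real" where
  "mval n f \<alpha> I = real_of_ereal (f I) + (\<Sum>j<n. real (Poly_Mapping.lookup I j) * \<alpha> j)"

text \<open>
  \<open>L\<close> is the set of the coordinates that are \<open>\<infinity>\<close>, the other coordinates are given by \<open>\<alpha>\<close>;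
  \<open>beats n L \<alpha> q p\<close> says that \<open>q\<close> takes a smaller value than \<open>p\<close> at this point.
\<close>

definition beats :: "nat \<Rightarrow> nat set \<Rightarrow> (nat \<Rightarrow> real) \<Rightarrow> tpoly \<Rightarrow> tpoly \<Rightarrow> bool" where
  "beats n L \<alpha> q p \<longleftrightarrow> (\<exists>I\<in>occurring q. Poly_Mapping.keys I \<inter> L = {} \<and>
     (\<forall>J\<in>occurring p. Poly_Mapping.keys J \<inter> L = {} \<longrightarrow> mval n q \<alpha> I < mval n p \<alpha> J))"

text \<open>A Boolean index for the components of a pair, \<open>\<not> s\<close> being the opposite
  one, lets arguments symmetric in the two be made once.\<close>

definition side :: "(tpoly \<times> tpoly) list \<Rightarrow> nat \<Rightarrow> bool \<Rightarrow> tpoly" where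
  "side F i s = (if s then fst (F ! i) else snd (F ! i))"

lemma side_in_system:
  "i < length F \<Longrightarrow> (side F i s, side F i (\<not> s)) \<in> set F \<or> (side F i (\<not> s), side F i s) \<in> set F"
  by (cases s) (auto simp: side_def)

lemma tpoly_side: "minplus_system K n F \<Longrightarrow> i < length F \<Longrightarrow> is_tpoly K n (side F i s)"
  by (force simp: minplus_system_def side_def dest: nth_mem)

lemma expvec_degree_le_tpoly_degree:
  "finite (occurring f) \<Longrightarrow> I \<in> occurring f \<Longrightarrow> expvec_degree I \<le> tpoly_degree f"
  by (auto simp: tpoly_degree_def)

lemma expvec_degree_side:
  assumes "minplus_system Rinf n F" "i < length F" "I \<in> occurring (side F i s)"
  shows "expvec_degree I \<le> pair_degree (F ! i)"
proof -
  have "expvec_degree I \<le> tpoly_degree (side F i s)"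
    using assms tpoly_side tpoly_finite_occurring expvec_degree_le_tpoly_degree by blast
  then show ?thesis by (auto simp: pair_degree_def side_def split: if_splits)
qed

lemma monom_mult_add [simp]: "monom_mult c M p (M + I) = ereal c + p I"
  by (auto simp: monom_mult_def)

lemma tpoly_sum_attained:
  assumes "K \<ge> 1"
  obtains t where "t < K" "tpoly_sum K h L = h t L"
proof -
  have "0 \<in> {..<K}" using assms by simp
  then have ne: "(\<lambda>t. h t L) ` {..<K} \<noteq> {}" by blast
  then have "tpoly_sum K h L = Min ((\<lambda>t. h t L) ` {..<K})"
    unfolding tpoly_sum_def by (intro cInf_eq_Min) auto
  then have "tpoly_sum K h L \<in> (\<lambda>t. h t L) ` {..<K}" using ne by simp
  then show ?thesis using that by auto
qed

lemma monom_mult_finite: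
  assumes "monom_mult c M p L \<noteq> \<infinity>"
  obtains I where "L = M + I" "I \<in> occurring p"
  using assms by (auto simp: monom_mult_def occurring_def split: if_splits)

lemma tpoly_degree_le:
  assumes "finite (occurring f)" "0 \<le> N" "\<And>I. I \<in> occurring f \<Longrightarrow> real (expvec_degree I) \<le> N"
  shows "real (tpoly_degree f) \<le> N"
proof -
  have "tpoly_degree f \<in> insert 0 (expvec_degree ` occurring f)"
    unfolding tpoly_degree_def using assms(1) by (intro Max_in) auto
  with assms show ?thesis by auto
qed

text \<open>
  The weights of the columns \<open>Mon i s I\<close> write an exponent vector as a nonnegative real combination
  of exponent vectors of the polynomials, with total weight at most \<open>n + 2\<close> for each pair, \<open>Slack i\<close>
  being the missing weight. One unit of weight of \<open>Mon\<close> additionally allows for \<open>c\<close> units of \<open>Unit\<close>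
  and \<open>Rest\<close>, where \<open>Unit j\<close> is the \<open>j\<close>-th unit vector and \<open>Rest\<close> the zero vector.
\<close>

datatype col = Mon nat bool expvec | Slack nat | Unit nat | Rest
datatype row = Var nat | Block nat | Tot

section \<open>The program, its dual points and the certificate read off from it\<close>

text \<open>\<open>X\<close> holds the auxiliary columns in use. Part (i) takes
  \<open>X = {}\<close> and \<open>c = \<beta> = 0\<close>; part (ii) takes all of them,
  \<open>c = (4 * d) ^ (min n (length F) + 2)\<close>, and for \<open>\<beta>\<close> a bound on the
  absolute values of the coefficients.\<close>

locale minplus_lp =
  fixes n :: nat and F :: "(tpoly \<times> tpoly) list" and X :: "col set" and c \<beta> :: real
  assumes system: "minplus_system Rinf n F"
    and X: "X \<subseteq> Slack ` {..<length F} \<union> Unit ` {..<n} \<union> {Rest}"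
    and c_nonneg: "0 \<le> c"
begin

definition mons :: "nat \<Rightarrow> col set" where
  "mons i = (\<lambda>(s, I). Mon i s I) ` (SIGMA s:UNIV. occurring (side F i s))"

definition cols :: "col set" where
  "cols = (\<Union>i<length F. mons i) \<union> X"

definition rows :: "row set" where
  "rows = Var ` {..<n} \<union> Block ` {..<length F} \<union> {Tot}"

fun entry :: "col \<Rightarrow> row \<Rightarrow> real" where
  "entry (Mon i s I) \<rho> = (case \<rho> of Var j \<Rightarrow> real (Poly_Mapping.lookup I j)
     | Block i' \<Rightarrow> if i' = i then 1 else 0 | Tot \<Rightarrow> - c)"
| "entry (Slack i) \<rho> = (if \<rho> = Block i then 1 else 0)"
| "entry (Unit j) \<rho> = (if \<rho> = Var j \<or> \<rho> = Tot then 1 else 0)"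
| "entry Rest \<rho> = (if \<rho> = Tot then 1 else 0)"

text \<open>The shift by \<open>c * \<beta>\<close> makes the dual constraints of \<open>Mon\<close>
  columns refer to the level \<open>c * (\<beta> - u Tot)\<close>. If \<open>Rest\<close> is
  present, then \<open>u Tot \<le> 0\<close>, so this scale is at least
  \<open>\<beta>\<close>.\<close>

fun cost :: "col \<Rightarrow> real" where
  "cost (Mon i s I) = real_of_ereal (side F i s I) - c * \<beta>"
| "cost _ = 0"

fun rhs :: "expvec \<Rightarrow> row \<Rightarrow> real" where
  "rhs J (Var j) = real (Poly_Mapping.lookup J j)"
| "rhs J (Block i) = real n + 2"
| "rhs J Tot = 0"

lemma Mon_in_mons [simp]: "Mon i s I \<in> mons i' \<longleftrightarrow> i = i' \<and> I \<in> occurring (side F i s)"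
  by (auto simp: mons_def)

lemma side_expvecs: "I \<in> occurring (side F i s) \<Longrightarrow> i < length F \<Longrightarrow> I \<in> expvecs n"
  using tpoly_occurring_expvecs[OF tpoly_side[OF system]] by auto

lemma finite_mons: "i < length F \<Longrightarrow> finite (mons i)"
  unfolding mons_def
  by (intro finite_imageI finite_SigmaI tpoly_finite_occurring[OF tpoly_side[OF system]]) auto

lemma finite_X: "finite X"
  using X by (rule finite_subset) auto

sublocale linear_program cols rows entry cost
  using finite_mons finite_X by unfold_locales (auto simp: cols_def rows_def)

lemma sum_rows: "(\<Sum>\<rho>\<in>rows. h \<rho>) = (\<Sum>j<n. h (Var j)) + (\<Sum>i<length F. h (Block i)) + h Tot"
  for h :: "row \<Rightarrow> real"
proof -
  have "(\<Sum>\<rho>\<in>rows. h \<rho>) = sum h (Var ` {..<n}) + sum h (Block ` {..<length F}) + h Tot"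
    unfolding rows_def by (subst sum.union_disjoint; auto simp: sum.union_disjoint)+
  then show ?thesis by (simp add: sum.reindex inj_on_def)
qed

lemma cols_cases:
  assumes "e \<in> cols"
  obtains (Mon) i s I where "e = Mon i s I" "i < length F" "I \<in> occurring (side F i s)"
  | (Slack) i where "e = Slack i" "i < length F" "e \<in> X"
  | (Unit) j where "e = Unit j" "j < n" "e \<in> X"
  | (Rest) "e = Rest" "e \<in> X"
  using assms X by (auto simp: cols_def mons_def)

lemma Mon_in_cols: "i < length F \<Longrightarrow> I \<in> occurring (side F i s) \<Longrightarrow> Mon i s I \<in> cols"
  by (auto simp: cols_def)

lemma entry_nonneg: "0 \<le> entry e (Var j)"
  by (cases e) auto

lemma dual_Mon:
  "(\<Sum>\<rho>\<in>rows. u \<rho> * entry (Mon i s I) \<rho>) =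
     (\<Sum>j<n. u (Var j) * real (Poly_Mapping.lookup I j)) + u (Block i) - c * u Tot" if "i < length F"
  using that by (simp add: sum_rows if_distrib[of "\<lambda>z. _ * z"] cong: if_cong)

lemma dual_others:
  "i < length F \<Longrightarrow> (\<Sum>\<rho>\<in>rows. u \<rho> * entry (Slack i) \<rho>) = u (Block i)"
  "j < n \<Longrightarrow> (\<Sum>\<rho>\<in>rows. u \<rho> * entry (Unit j) \<rho>) = u (Var j) + u Tot"
  "(\<Sum>\<rho>\<in>rows. u \<rho> * entry Rest \<rho>) = u Tot"
  by (simp_all add: sum_rows if_distrib[of "\<lambda>z. _ * z"] cong: if_cong)

lemma dual_exists: "\<exists>u. dual u"
proof -
  \<comment> \<open>A block value is at most the costs of its \<open>Mon\<close> columns, and at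
    most \<open>0\<close> because of a possible \<open>Slack\<close> column.\<close>
  define u where "u = (\<lambda>\<rho>. case \<rho> of Block i \<Rightarrow> Min (insert 0 (cost ` mons i)) | _ \<Rightarrow> 0)"
  have "(\<Sum>\<rho>\<in>rows. u \<rho> * entry e \<rho>) \<le> cost e" if "e \<in> cols" for e
    using that
  proof (cases rule: cols_cases)
    case (Mon i s I)
    have "Min (insert 0 (cost ` mons i)) \<le> cost e"
      using Mon finite_mons[of i] by (intro Min_le insertI2 imageI) auto
    with Mon show ?thesis by (simp only: dual_Mon) (simp add: u_def)
  next
    case (Slack i)
    with finite_mons[of i] show ?thesis by (simp only: dual_others) (simp add: u_def)
  next
    case (Unit j)
    then show ?thesis by (simp only: dual_others) (simp add: u_def)
  next
    case Rest
    then show ?thesis by (simp only: dual_others) (simp add: u_def)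
  qed
  then show ?thesis by (auto simp: dual_def)
qed

text \<open>A dual vector is read as the point with coordinates \<open>- u (Var j)\<close>: a block
  value bounds the shifted monomial values of its pair at that point from below, and the tight
  columns are the monomials attaining this bound.\<close>

lemma dual_mval:
  assumes "i < length F"
  shows "(\<Sum>\<rho>\<in>rows. u \<rho> * entry (Mon i s I) \<rho>) \<le> cost (Mon i s I) \<longleftrightarrow>
      u (Block i) \<le> mval n (side F i s) (\<lambda>j. - u (Var j)) I - c * (\<beta> - u Tot)"
    and "(\<Sum>\<rho>\<in>rows. u \<rho> * entry (Mon i s I) \<rho>) = cost (Mon i s I) \<longleftrightarrow>
      u (Block i) = mval n (side F i s) (\<lambda>j. - u (Var j)) I - c * (\<beta> - u Tot)"
  by (simp_all only: dual_Mon[OF assms])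
     (auto simp: mval_def algebra_simps sum_negf)

text \<open>These exponent vectors index the rows of the certificate; all monomials of the rows lie
  among them again.\<close>

definition reach :: "expvec set" where
  "reach = {J \<in> expvecs n. \<exists>x. primal (rhs J) x}"

text \<open>The equations are paired with a vector \<open>u\<close> that counts the degree on the
  \<open>Var\<close> rows and charges \<open>pair_degree (F ! i) + c\<close> per unit of block
  weight. It is nonpositive on every column; its \<open>Tot\<close> entry passes the cost of the
  unit vectors on to the \<open>Mon\<close> columns.\<close>

lemma reach_degree:
  assumes "J \<in> reach"
  shows "real (expvec_degree J) \<le> (real n + 2) * (\<Sum>i<length F. real (pair_degree (F ! i)) + c)"
proof -
  obtain x where J: "J \<in> expvecs n" and x: "primal (rhs J) x" using assms by (auto simp: reach_def)
  define u where "u = (\<lambda>\<rho>. case \<rho> of Var _ \<Rightarrow> 1 | Block i \<Rightarrow> - (real (pair_degree (F ! i)) + c) | Tot \<Rightarrow> - 1)"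
  have "(\<Sum>\<rho>\<in>rows. u \<rho> * entry e \<rho>) \<le> 0" if "e \<in> cols" for e
    using that
  proof (cases rule: cols_cases)
    case (Mon i s I)
    have "I \<in> expvecs n" using Mon(3,2) by (rule side_expvecs)
    then have "real (\<Sum>j<n. Poly_Mapping.lookup I j) \<le> real (pair_degree (F ! i))"
      using expvec_degree_side[OF system Mon(2,3)] by (simp only: expvec_degree_eq of_nat_le_iff)
    with Mon show ?thesis by (simp only: dual_Mon) (simp add: u_def)
  next
    case (Slack i)
    with c_nonneg show ?thesis by (simp only: dual_others) (simp add: u_def)
  next
    case (Unit j)
    then show ?thesis by (simp only: dual_others) (simp add: u_def)
  next
    case Rest
    then show ?thesis by (simp only: dual_others) (simp add: u_def)
  qed
  then have "(\<Sum>e\<in>cols. x e * (\<Sum>\<rho>\<in>rows. u \<rho> * entry e \<rho>)) \<le> 0"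
    using x by (intro sum_nonpos) (auto simp: primal_def mult_nonneg_nonpos)
  then have "(\<Sum>\<rho>\<in>rows. u \<rho> * rhs J \<rho>) \<le> 0"
    using x by (subst primal_pairing) (auto simp: primal_def)
  moreover have "(\<Sum>\<rho>\<in>rows. u \<rho> * rhs J \<rho>) = real (expvec_degree J)
      - (real n + 2) * (\<Sum>i<length F. real (pair_degree (F ! i)) + c)"
  proof -
    have "(\<Sum>i<length F. u (Block i) * rhs J (Block i)) =
        - ((real n + 2) * (\<Sum>i<length F. real (pair_degree (F ! i)) + c))"
      unfolding sum_distrib_left sum_negf[symmetric]
      by (intro sum.cong) (auto simp: u_def algebra_simps)
    then show ?thesis by (simp add: sum_rows u_def expvec_degree_eq[OF J])
  qed
  ultimately show ?thesis by linarith
qed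

lemma finite_reach: "finite reach"
proof -
  obtain N where "(real n + 2) * (\<Sum>i<length F. real (pair_degree (F ! i)) + c) \<le> real N"
    using real_arch_simple ..
  then have "expvec_degree J \<le> N" if "J \<in> reach" for J
    using reach_degree[OF that] by linarith
  then have "reach \<subseteq> {J \<in> expvecs n. expvec_degree J \<le> N}"
    by (auto simp: reach_def)
  then show ?thesis using finite_bounded_expvecs by (rule finite_subset)
qed

text \<open>
  Caratheodory's theorem in block \<open>i\<close>: in a basic solution at most \<open>n + 1\<close> columns of a block of
  total weight \<open>n + 2\<close> are used, so that one of them has weight above \<open>1\<close>.
\<close>

lemma heavy_column:
  assumes "i < length F"
    and basic: "\<And>\<gamma> e. (\<forall>\<rho>\<in>rows. (\<Sum>e\<in>{e\<in>cols. x e > 0}. \<gamma> e * entry e \<rho>) = 0) \<Longrightarrow>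
      e \<in> cols \<Longrightarrow> x e > 0 \<Longrightarrow> \<gamma> e = 0"
    and nonneg: "\<forall>e\<in>cols. 0 \<le> x e"
    and weight: "(\<Sum>e\<in>mons i. x e) = real n + 2"
  shows "\<exists>e\<in>mons i. 1 < x e"
proof (rule ccontr)
  assume light: "\<not> (\<exists>e\<in>mons i. 1 < x e)"
  define B where "B = {e \<in> mons i. x e > 0}"
  have sub: "mons i \<subseteq> cols" using assms(1) by (auto simp: cols_def)
  have fin: "finite (mons i)" using finite_mons[OF assms(1)] .
  have "(\<Sum>e\<in>mons i. x e) = (\<Sum>e\<in>B. x e)"
    using nonneg sub fin by (intro sum.mono_neutral_right) (force simp: B_def)+
  also have "\<dots> \<le> (\<Sum>e\<in>B. 1)"
    using light by (intro sum_mono) (auto simp: B_def not_less)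
  finally have "real n + 2 \<le> real (card B)" using weight by simp
  moreover have "card (insert (Block i) (Var ` {..<n})) = Suc n"
    by (subst card_insert_disjoint) (auto simp: card_image inj_on_def)
  ultimately have "card (insert (Block i) (Var ` {..<n})) < card B" by linarith
  moreover have "finite B" using fin by (simp add: B_def)
  ultimately obtain \<gamma> where \<gamma>: "\<exists>e\<in>B. \<gamma> e \<noteq> 0"
      "\<forall>\<rho>\<in>insert (Block i) (Var ` {..<n}). (\<Sum>e\<in>B. \<gamma> e * entry e \<rho>) = 0"
    using homogeneous_system_solution[of "insert (Block i) (Var ` {..<n})" B entry] by auto
  define \<gamma>' where "\<gamma>' = (\<lambda>e. if e \<in> B then \<gamma> e else 0)"
  have "(\<Sum>e\<in>{e\<in>cols. x e > 0}. \<gamma>' e * entry e \<rho>) = 0" if "\<rho> \<in> rows" for \<rho>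
  proof -
    have "(\<Sum>e\<in>{e\<in>cols. x e > 0}. \<gamma>' e * entry e \<rho>) = (\<Sum>e\<in>B. \<gamma> e * entry e \<rho>)"
      using finite_E sub by (intro sum.mono_neutral_cong_right) (auto simp: B_def \<gamma>'_def)
    also have "\<dots> = 0"
    proof (cases \<rho>)
      case (Var j)
      then show ?thesis using \<gamma>(2) that by (auto simp: rows_def)
    next
      case (Block i')
      show ?thesis
      proof (cases "i' = i")
        case False
        then show ?thesis using Block by (intro sum.neutral) (auto simp: B_def mons_def)
      qed (use Block \<gamma>(2) in auto)
    next
      case Tot
      \<comment> \<open>Within one block the \<open>Tot\<close> row is \<open>- c\<close> times the
        \<open>Block\<close> row, so it adds no equation to the \<open>n + 1\<close> already
        solved.\<close>
      have "(\<Sum>e\<in>B. \<gamma> e * entry e \<rho>) = (\<Sum>e\<in>B. - c * (\<gamma> e * entry e (Block i)))"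
        using Tot by (intro sum.cong) (auto simp: B_def mons_def)
      also have "\<dots> = - c * (\<Sum>e\<in>B. \<gamma> e * entry e (Block i))" by (rule sum_distrib_left[symmetric])
      finally show ?thesis using \<gamma>(2) by simp
    qed
    finally show ?thesis .
  qed
  then have "\<gamma>' e = 0" if "e \<in> B" for e using basic[of \<gamma>'] that sub by (auto simp: B_def)
  with \<gamma>(1) show False by (auto simp: \<gamma>'_def)
qed

text \<open>The entries in the \<open>Var\<close> rows are nonnegative, so a column of weight at
  least \<open>1\<close> forces \<open>I\<close> to lie below \<open>J\<close> in every coordinate
  and \<open>J - I\<close> loses nothing. Columns of the same pair agree in the \<open>Block\<close>
  and \<open>Tot\<close> rows, so trading one for another only changes the exponent vector.\<close>

lemma reach_exchange:
  assumes J: "J \<in> expvecs n" and x: "primal (rhs J) x" and i: "i < length F"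
    and I: "I \<in> occurring (side F i s)" "1 \<le> x (Mon i s I)"
  obtains M where "M \<in> expvecs n" "J = M + I"
    "\<And>s' I'. I' \<in> occurring (side F i s') \<Longrightarrow> M + I' \<in> reach"
    "\<And>s' I' \<rho>. rhs (M + I') \<rho> = rhs J \<rho> - entry (Mon i s I) \<rho> + entry (Mon i s' I') \<rho>"
proof -
  define M where "M = J - I"
  have le: "Poly_Mapping.lookup I j \<le> Poly_Mapping.lookup J j" for j
  proof (cases "j < n")
    case True
    have "real (Poly_Mapping.lookup I j) \<le> x (Mon i s I) * entry (Mon i s I) (Var j)"
      using mult_right_mono[OF I(2), of "real (Poly_Mapping.lookup I j)"] by simp
    also have "\<dots> \<le> (\<Sum>e\<in>cols. x e * entry e (Var j))"
      using x Mon_in_cols[OF i I(1)] finite_E entry_nonneg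
      by (intro member_le_sum) (auto simp: primal_def)
    also have "\<dots> = real (Poly_Mapping.lookup J j)"
    proof -
      have "Var j \<in> rows" using True by (auto simp: rows_def)
      with x show ?thesis by (auto simp: primal_def)
    qed
    finally show ?thesis by simp
  next
    case False
    moreover have "I \<in> expvecs n" using I(1) i by (rule side_expvecs)
    ultimately show ?thesis using lookup_outside_expvecs by simp
  qed
  have eq: "J = M + I"
    by (rule poly_mapping_eqI) (use le in \<open>simp add: M_def lookup_add lookup_minus\<close>)
  have rhs_eq: "rhs (M + I') \<rho> = rhs J \<rho> - entry (Mon i s I) \<rho> + entry (Mon i s' I') \<rho>" for s' I' \<rho>
    by (cases \<rho>) (auto simp: eq lookup_add)
  have M: "M \<in> expvecs n" using J eq by (simp add: expvecs_add_iff)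
  have "M + I' \<in> reach" if "I' \<in> occurring (side F i s')" for s' I'
  proof -
    have "I' \<in> expvecs n" using that i by (rule side_expvecs)
    moreover have "\<exists>z. primal (rhs (M + I')) z"
      using primal_exchange(1)[OF x Mon_in_cols[OF i I(1)] Mon_in_cols[OF i that] I(2) rhs_eq] by blast
    ultimately show ?thesis using M by (auto simp: reach_def expvecs_add_iff)
  qed
  from that[OF M eq this rhs_eq] show ?thesis .
qed

text \<open>By slackness a column in use attains the bound given by the block value. If side
  \<open>s\<close> wins at the dual point, every monomial of the other side lies strictly above that
  bound, so the column belongs to \<open>s\<close>.\<close>

lemma beats_selects_column:
  assumes opt: "optimal (rhs J) x u" and i: "i < length F"
    and e: "e \<in> mons i" "0 < x e"
    and beats: "beats n {} (\<lambda>j. - u (Var j)) (side F i s) (side F i (\<not> s))"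
  obtains I where "e = Mon i s I" "I \<in> occurring (side F i s)"
    "\<And>I'. I' \<in> occurring (side F i (\<not> s)) \<Longrightarrow>
      (\<Sum>\<rho>\<in>rows. u \<rho> * entry (Mon i (\<not> s) I') \<rho>) < cost (Mon i (\<not> s) I')"
proof -
  let ?m = "\<lambda>s I. mval n (side F i s) (\<lambda>j. - u (Var j)) I - c * (\<beta> - u Tot)"
  have px: "primal (rhs J) x" and du: "dual u" using opt by (auto simp: optimal_def)
  obtain I0 where I0: "I0 \<in> occurring (side F i s)"
      "\<And>I'. I' \<in> occurring (side F i (\<not> s)) \<Longrightarrow> ?m s I0 < ?m (\<not> s) I'"
    using beats by (auto simp: beats_def)
  have "u (Block i) \<le> ?m s I0"
    using du Mon_in_cols[OF i I0(1)] dual_mval(1)[OF i] by (auto simp: dual_def)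
  with I0(2) have less: "u (Block i) < ?m (\<not> s) I'" if "I' \<in> occurring (side F i (\<not> s))" for I'
    using that by fastforce
  obtain s' I where e_eq: "e = Mon i s' I" and I: "I \<in> occurring (side F i s')"
    using e(1) by (auto simp: mons_def)
  have "u (Block i) = ?m s' I"
    using opt optimal_iff_slackness[OF px du] e(2) Mon_in_cols[OF i I] dual_mval(2)[OF i] e_eq by blast
  with less I have s': "s' = s" by (cases s; cases s') force+
  show ?thesis
  proof (rule that)
    show "e = Mon i s I" "I \<in> occurring (side F i s)" using e_eq I s' by auto
    show "(\<Sum>\<rho>\<in>rows. u \<rho> * entry (Mon i (\<not> s) I') \<rho>) < cost (Mon i (\<not> s) I')"
      if I': "I' \<in> occurring (side F i (\<not> s))" for I'
      using less[OF I'] dual_mval[OF i, of u "\<not> s" I'] by linarith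
  qed
qed

text \<open>The data of the row of \<open>J\<close>: side \<open>s\<close> of pair \<open>i\<close>
  goes to the second component, \<open>M\<close> is the exponent of the multiplier, and
  \<open>I\<close> is the monomial that yields \<open>J\<close>.\<close>

definition good_exchange ::
  "expvec \<Rightarrow> (col \<Rightarrow> real) \<Rightarrow> (row \<Rightarrow> real) \<Rightarrow> nat \<Rightarrow> bool \<Rightarrow> expvec \<Rightarrow> expvec \<Rightarrow> bool" where
  "good_exchange J x u i s I M \<longleftrightarrow> optimal (rhs J) x u \<and> i < length F \<and>
     I \<in> occurring (side F i s) \<and> 1 < x (Mon i s I) \<and>
     (\<forall>I'\<in>occurring (side F i (\<not> s)).
        (\<Sum>\<rho>\<in>rows. u \<rho> * entry (Mon i (\<not> s) I') \<rho>) < cost (Mon i (\<not> s) I')) \<and>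
     M \<in> expvecs n \<and> J = M + I \<and>
     (\<forall>s' I'. I' \<in> occurring (side F i s') \<longrightarrow> M + I' \<in> reach) \<and>
     (\<forall>s' I' \<rho>. rhs (M + I') \<rho> = rhs J \<rho> - entry (Mon i s I) \<rho> + entry (Mon i s' I') \<rho>)"

text \<open>The separated pair in \<open>nonroot\<close> leaves out no weight, so a basic solution
  has a heavy column in it, which lies on the winning side.\<close>

lemma good_exchange_exists:
  assumes nonroot: "\<And>J x u. J \<in> reach \<Longrightarrow> optimal (rhs J) x u \<Longrightarrow>
      \<exists>i<length F. \<exists>s. (\<Sum>e\<in>mons i. x e) = real n + 2 \<and>
        beats n {} (\<lambda>j. - u (Var j)) (side F i s) (side F i (\<not> s))"
    and J: "J \<in> reach"
  shows "\<exists>x u i s I M. good_exchange J x u i s I M"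
proof -
  obtain x0 u0 where p0: "primal (rhs J) x0" and d0: "dual u0"
    using J dual_exists by (auto simp: reach_def)
  obtain x1 u where opt1: "optimal (rhs J) x1 u" using strong_duality[OF p0 d0] by blast
  obtain x where opt: "optimal (rhs J) x u"
    and basic: "\<And>\<gamma> e. (\<forall>\<rho>\<in>rows. (\<Sum>e\<in>{e\<in>cols. x e > 0}. \<gamma> e * entry e \<rho>) = 0) \<Longrightarrow>
      e \<in> cols \<Longrightarrow> x e > 0 \<Longrightarrow> \<gamma> e = 0"
    using basic_optimal[OF opt1] by blast
  have px: "primal (rhs J) x" using opt by (simp add: optimal_def)
  obtain i s where i: "i < length F" and weight: "(\<Sum>e\<in>mons i. x e) = real n + 2"
    and beats: "beats n {} (\<lambda>j. - u (Var j)) (side F i s) (side F i (\<not> s))"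
    using nonroot[OF J opt] by blast
  have nonneg: "\<forall>e\<in>cols. 0 \<le> x e" using px by (simp add: primal_def)
  obtain e where e: "e \<in> mons i" "1 < x e"
    using heavy_column[of i x, OF i _ nonneg weight] basic by blast
  obtain I where I: "e = Mon i s I" "I \<in> occurring (side F i s)"
    "\<And>I'. I' \<in> occurring (side F i (\<not> s)) \<Longrightarrow>
      (\<Sum>\<rho>\<in>rows. u \<rho> * entry (Mon i (\<not> s) I') \<rho>) < cost (Mon i (\<not> s) I')"
    using beats_selects_column[OF opt i e(1) _ beats] e(2) by auto
  have "J \<in> expvecs n" "1 \<le> x (Mon i s I)" using J I e by (auto simp: reach_def)
  from reach_exchange[OF this(1) px i I(2) this(2)] obtain M where "M \<in> expvecs n" "J = M + I"
    "\<And>s' I'. I' \<in> occurring (side F i s') \<Longrightarrow> M + I' \<in> reach"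
    "\<And>s' I' \<rho>. rhs (M + I') \<rho> = rhs J \<rho> - entry (Mon i s I) \<rho> + entry (Mon i s' I') \<rho>" by metis
  with opt i I e show ?thesis unfolding good_exchange_def by blast
qed

text \<open>One row is taken for each \<open>J\<close> in \<open>reach\<close>. Exchanging
  \<open>I J\<close> for a monomial \<open>I'\<close> of the losing side costs
  \<open>gain J I'\<close>, which bounds the optimal value \<open>\<psi>\<close> at
  \<open>M J + I'\<close>; in case of equality the dual optima shrink, so
  \<open>strict_potential\<close> applies.\<close>

lemma certificate:
  assumes nonroot: "\<And>J x u. J \<in> reach \<Longrightarrow> optimal (rhs J) x u \<Longrightarrow>
      \<exists>i<length F. \<exists>s. (\<Sum>e\<in>mons i. x e) = real n + 2 \<and>
        beats n {} (\<lambda>j. - u (Var j)) (side F i s) (side F i (\<not> s))"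
    and "reach \<noteq> {}"
  shows "\<exists>f g. alg_combination n F (f, g) \<and> coeffs_greater f g \<and> (\<forall>J\<in>reach. g J \<noteq> \<infinity>) \<and>
      real (pair_degree (f, g)) \<le> (real n + 2) * (\<Sum>i<length F. real (pair_degree (F ! i)) + c)"
proof -
  obtain x u i s I M where good: "\<And>J. J \<in> reach \<Longrightarrow> good_exchange J (x J) (u J) (i J) (s J) (I J) (M J)"
  proof -
    have "\<forall>J\<in>reach. \<exists>x u i s I M. good_exchange J x u i s I M"
      using nonroot by (intro ballI good_exchange_exists) auto
    then show thesis using that by metis
  qed
  have
    sel: "\<And>J. J \<in> reach \<Longrightarrow> optimal (rhs J) (x J) (u J)"
      "\<And>J. J \<in> reach \<Longrightarrow> i J < length F"
      "\<And>J. J \<in> reach \<Longrightarrow> I J \<in> occurring (side F (i J) (s J))"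
      "\<And>J. J \<in> reach \<Longrightarrow> 1 < x J (Mon (i J) (s J) (I J))"
      "\<And>J I'. J \<in> reach \<Longrightarrow> I' \<in> occurring (side F (i J) (\<not> s J)) \<Longrightarrow>
        (\<Sum>\<rho>\<in>rows. u J \<rho> * entry (Mon (i J) (\<not> s J) I') \<rho>) < cost (Mon (i J) (\<not> s J) I')"
      "\<And>J. J \<in> reach \<Longrightarrow> M J \<in> expvecs n" "\<And>J. J \<in> reach \<Longrightarrow> J = M J + I J"
      "\<And>J s' I'. J \<in> reach \<Longrightarrow> I' \<in> occurring (side F (i J) s') \<Longrightarrow> M J + I' \<in> reach"
      "\<And>J s' I' \<rho>. J \<in> reach \<Longrightarrow> rhs (M J + I') \<rho> =
        rhs J \<rho> - entry (Mon (i J) (s J) (I J)) \<rho> + entry (Mon (i J) s' I') \<rho>"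
    using good unfolding good_exchange_def by blast+
  define q where "q = (\<lambda>J. side F (i J) (s J))"
  define p where "p = (\<lambda>J. side F (i J) (\<not> s J))"
  define \<psi> where "\<psi> = (\<lambda>J. \<Sum>e\<in>cols. x J e * cost e)"
  define D where "D = (\<lambda>J. {v. \<exists>z. optimal (rhs J) z v})"
  define gain where "gain = (\<lambda>J I'. real_of_ereal (p J I') - real_of_ereal (q J (I J)))"
  define G where "G = (\<lambda>(J, I'). (J, M J + I', gain J I')) ` (SIGMA J:reach. occurring (p J))"
  have tpoly: "is_tpoly Rinf n (q J)" "is_tpoly Rinf n (p J)" if "J \<in> reach" for J
    using tpoly_side[OF system] sel(2) that by (auto simp: q_def p_def)
  have "\<exists>\<theta>. \<forall>(J, J', g)\<in>G. \<theta> J' < \<theta> J + g"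
  proof (rule strict_potential)
    show "finite reach" by (rule finite_reach)
    show "finite G"
      unfolding G_def using finite_reach tpoly tpoly_finite_occurring
      by (intro finite_imageI finite_SigmaI) auto
    fix J J' g assume "(J, J', g) \<in> G"
    then obtain I' where J: "J \<in> reach" and I': "I' \<in> occurring (side F (i J) (\<not> s J))"
      and J': "J' = M J + I'" and g: "g = gain J I'"
      by (auto simp: G_def p_def)
    have J'_reach: "J' \<in> reach" using sel(8)[OF J I'] J' by simp
    let ?e = "Mon (i J) (s J) (I J)" and ?e' = "Mon (i J) (\<not> s J) I'"
    have g_cost: "g = cost ?e' - cost ?e" by (simp add: g gain_def p_def q_def)
    note exch = optimal_exchange[OF sel(1)[OF J] sel(1)[OF J'_reach]
        Mon_in_cols[OF sel(2)[OF J] sel(3)[OF J]] Mon_in_cols[OF sel(2)[OF J] I']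
        sel(4)[OF J] sel(5)[OF J I'] sel(9)[OF J, of I', folded J']]
    show "J' \<in> reach \<and> \<psi> J' \<le> \<psi> J + g \<and> (\<psi> J' = \<psi> J + g \<longrightarrow> D J' \<subset> D J)"
    proof (intro conjI impI)
      show "\<psi> J' \<le> \<psi> J + g" using exch(1) g_cost by (simp add: \<psi>_def)
      show "D J' \<subset> D J" if "\<psi> J' = \<psi> J + g"
        unfolding D_def using that g_cost by (intro exch(2)) (simp add: \<psi>_def)
    qed (rule J'_reach)
  qed
  then obtain \<theta> where \<theta>_G: "\<forall>(J, J', g)\<in>G. \<theta> J' < \<theta> J + g" by blast
  have \<theta>: "\<theta> (M J + I') < \<theta> J + gain J I'" if "J \<in> reach" "I' \<in> occurring (p J)" for J I'
  proof -
    have "(J, M J + I', gain J I') \<in> G" using that by (force simp: G_def)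
    with \<theta>_G show ?thesis by auto
  qed
  define K where "K = card reach"
  have K: "K \<ge> 1" using assms(2) finite_reach by (simp add: K_def Suc_le_eq card_gt_0_iff)
  obtain \<phi> where "bij_betw \<phi> {0..<K} reach"
    using ex_bij_betw_nat_finite[OF finite_reach] unfolding K_def by blast
  then have \<phi>: "\<phi> ` {..<K} = reach" by (simp add: bij_betw_def atLeast0LessThan)
  \<comment> \<open>With this coefficient the monomial \<open>I J\<close> of \<open>q J\<close>
    contributes exactly \<open>\<theta> J\<close> at \<open>J\<close>, and \<open>I'\<close> in
    \<open>p J\<close> contributes \<open>\<theta> J + gain J I'\<close>.\<close>
  define cc where "cc = (\<lambda>J. \<theta> J - real_of_ereal (q J (I J)))"
  define f where "f = tpoly_sum K (\<lambda>t. monom_mult (cc (\<phi> t)) (M (\<phi> t)) (p (\<phi> t)))"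
  define g where "g = tpoly_sum K (\<lambda>t. monom_mult (cc (\<phi> t)) (M (\<phi> t)) (q (\<phi> t)))"
  have \<phi>_reach: "\<phi> t \<in> reach" if "t < K" for t using \<phi> that by auto
  \<comment> \<open>The potential \<open>\<theta>\<close> separates the components: \<open>g\<close>
    stays at or below it on \<open>reach\<close>, and \<open>f\<close> is strictly above it.\<close>
  have g_le: "g J \<le> ereal (\<theta> J)" if J: "J \<in> reach" for J
  proof -
    have "J \<in> \<phi> ` {..<K}" using J \<phi> by simp
    then obtain t where t: "t < K" "\<phi> t = J" by auto
    have "g J \<le> monom_mult (cc J) (M J) (q J) J"
      unfolding g_def tpoly_sum_def using t by (intro INF_lower2[of t]) auto
    also have "\<dots> = ereal (cc J) + q J (I J)"
      by (subst (4) sel(7)[OF J]) simp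
    also have "q J (I J) = ereal (real_of_ereal (q J (I J)))"
      using tpoly_coeff[OF tpoly(1)[OF J]] sel(3)[OF J] by (simp add: q_def)
    finally show ?thesis by (simp add: cc_def)
  qed
  have occ_f: "L \<in> reach \<and> ereal (\<theta> L) < f L" if L: "L \<in> occurring f" for L
  proof -
    obtain t where t: "t < K" "f L = monom_mult (cc (\<phi> t)) (M (\<phi> t)) (p (\<phi> t)) L"
      using tpoly_sum_attained[OF K] unfolding f_def by blast
    with L obtain I' where I': "L = M (\<phi> t) + I'" "I' \<in> occurring (p (\<phi> t))"
      by (auto simp: occurring_def elim: monom_mult_finite)
    note J = \<phi>_reach[OF t(1)]
    have "f L = ereal (cc (\<phi> t)) + p (\<phi> t) I'" using t I' by simp
    also have "p (\<phi> t) I' = ereal (real_of_ereal (p (\<phi> t) I'))"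
      using tpoly_coeff[OF tpoly(2)[OF J]] I'(2) by simp
    finally have "f L = ereal (\<theta> (\<phi> t) + gain (\<phi> t) I')" by (simp add: cc_def gain_def)
    then show ?thesis using \<theta>[OF J I'(2)] sel(8)[OF J] I' by (simp add: p_def)
  qed
  have occ_g: "L \<in> reach" if L: "L \<in> occurring g" for L
  proof -
    obtain t where t: "t < K" "g L = monom_mult (cc (\<phi> t)) (M (\<phi> t)) (q (\<phi> t)) L"
      using tpoly_sum_attained[OF K] unfolding g_def by blast
    with L obtain I' where I': "L = M (\<phi> t) + I'" "I' \<in> occurring (q (\<phi> t))"
      by (auto simp: occurring_def elim: monom_mult_finite)
    then show ?thesis using sel(8)[OF \<phi>_reach[OF t(1)]] by (simp add: q_def)
  qed
  have "alg_combination n F (f, g)"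
    unfolding alg_combination_def
  proof (intro exI conjI allI impI)
    fix t assume t: "t < K"
    show "M (\<phi> t) \<in> expvecs n" using sel(6) \<phi>_reach[OF t] .
    show "(p (\<phi> t), q (\<phi> t)) \<in> set F \<or> (q (\<phi> t), p (\<phi> t)) \<in> set F"
      using side_in_system[OF sel(2)[OF \<phi>_reach[OF t]]] by (auto simp: p_def q_def)
  qed (use K in \<open>auto simp: f_def g_def\<close>)
  moreover have "coeffs_greater f g"
    unfolding coeffs_greater_def
  proof
    fix L assume "L \<in> occurring f \<union> occurring g"
    then have L: "L \<in> reach" using occ_f occ_g by blast
    show "f L > g L"
    proof (cases "L \<in> occurring f")
      case True
      then show ?thesis using occ_f g_le[OF L] by (meson le_less_trans)
    next
      case False
      then show ?thesis using g_le[OF L] by (auto simp: occurring_def intro: le_less_trans)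
    qed
  qed
  moreover have "\<forall>J\<in>reach. g J \<noteq> \<infinity>" using g_le by force
  moreover have "real (pair_degree (f, g)) \<le>
      (real n + 2) * (\<Sum>i<length F. real (pair_degree (F ! i)) + c)" (is "_ \<le> ?N")
  proof -
    have "occurring f \<subseteq> reach" "occurring g \<subseteq> reach" using occ_f occ_g by auto
    moreover have "0 \<le> ?N" using c_nonneg by (intro mult_nonneg_nonneg sum_nonneg) auto
    ultimately have "real (tpoly_degree f) \<le> ?N" "real (tpoly_degree g) \<le> ?N"
      using reach_degree finite_reach by (auto intro!: tpoly_degree_le intro: finite_subset)
    then show ?thesis by (simp add: pair_degree_def)
  qed
  ultimately show ?thesis by blast
qed

end

section \<open>Roots and certificates\<close>

lemma monom_eval_eq:
  "I \<in> expvecs n \<Longrightarrow> monom_eval I a = (\<Sum>j<n. ereal (real (Poly_Mapping.lookup I j)) * a j)"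
  unfolding monom_eval_def
  by (intro sum.mono_neutral_left) (auto simp: expvecs_def in_keys_iff)

lemma monom_eval_add:
  assumes "I \<in> expvecs n" "J \<in> expvecs n"
  shows "monom_eval (I + J) a = monom_eval I a + monom_eval J a"
proof -
  have "ereal (real (Poly_Mapping.lookup (I + J) j)) * a j =
      ereal (real (Poly_Mapping.lookup I j)) * a j + ereal (real (Poly_Mapping.lookup J j)) * a j" for j
    by (simp add: lookup_add ereal_left_distrib[symmetric])
  then show ?thesis
    using assms by (simp add: monom_eval_eq[of _ n] expvecs_add_iff sum.distrib)
qed

text \<open>Because \<open>0 * \<infinity> = 0\<close>, an infinite coordinate matters only to the
  monomials containing its variable.\<close>

lemma monom_eval_value:
  assumes I: "I \<in> expvecs n" and a: "\<And>j. j < n \<Longrightarrow> a j = (if j \<in> L then \<infinity> else ereal (\<alpha> j))"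
    and L: "L \<subseteq> {..<n}"
  shows "monom_eval I a = (if Poly_Mapping.keys I \<inter> L = {}
    then ereal (\<Sum>j<n. real (Poly_Mapping.lookup I j) * \<alpha> j) else \<infinity>)"
proof (cases "Poly_Mapping.keys I \<inter> L = {}")
  case True
  have "ereal (real (Poly_Mapping.lookup I j)) * a j = ereal (real (Poly_Mapping.lookup I j) * \<alpha> j)"
    if "j < n" for j
    using True a[OF that] by (auto simp: in_keys_iff zero_ereal_def[symmetric])
  then show ?thesis using True by (simp add: monom_eval_eq[OF I])
next
  case False
  then obtain j where "j \<in> Poly_Mapping.keys I" "j \<in> L" by blast
  then have "j < n" "ereal (real (Poly_Mapping.lookup I j)) * a j = \<infinity>"
    using L a[of j] by (auto simp: in_keys_iff)
  then have "monom_eval I a = \<infinity>"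
    unfolding monom_eval_eq[OF I] by (subst sum_Pinfty) auto
  then show ?thesis using False by simp
qed

lemma beats_if_eval_less:
  assumes f: "is_tpoly Rinf n f" and g: "is_tpoly Rinf n g" and L: "L \<subseteq> {..<n}"
    and a: "\<And>j. j < n \<Longrightarrow> a j = (if j \<in> L then \<infinity> else ereal (\<alpha> j))"
    and less: "tpoly_eval g a < tpoly_eval f a"
  shows "beats n L \<alpha> g f"
proof -
  have val: "h I + monom_eval I a = (if Poly_Mapping.keys I \<inter> L = {} then ereal (mval n h \<alpha> I) else \<infinity>)"
    if "is_tpoly Rinf n h" "I \<in> occurring h" for h I
  proof -
    have "I \<in> expvecs n" using tpoly_occurring_expvecs that by blast
    from monom_eval_value[OF this a L] show ?thesis
      using tpoly_coeff[OF that] by (cases "h I") (auto simp: mval_def)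
  qed
  obtain I where I: "I \<in> occurring g" "g I + monom_eval I a < tpoly_eval f a"
    using less by (auto simp: tpoly_eval_def[of g] INF_less_iff)
  have lt: "g I + monom_eval I a < f J + monom_eval J a" if "J \<in> occurring f" for J
    using I(2) INF_lower[OF that, of "\<lambda>J. f J + monom_eval J a"]
    unfolding tpoly_eval_def by (rule less_le_trans)
  have free: "Poly_Mapping.keys I \<inter> L = {}"
    using I(2) val[OF g I(1)] by (auto split: if_splits)
  moreover have "mval n g \<alpha> I < mval n f \<alpha> J"
    if "J \<in> occurring f" "Poly_Mapping.keys J \<inter> L = {}" for J
    using lt[OF that(1)] val[OF g I(1)] val[OF f that(1)] free that(2) by simp
  ultimately show ?thesis using I(1) by (auto simp: beats_def)
qed

lemma range_ereal_subset: "range ereal \<subseteq> Rfin" "range ereal \<subseteq> Rinf"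
  unfolding Rfin_def Rinf_def by blast+

lemma no_root_beats:
  assumes sys: "minplus_system Rinf n F" and no_root: "system_roots K n F = {}"
    and K: "range ereal \<subseteq> K" "L = {} \<or> \<infinity> \<in> K" and L: "L \<subseteq> {..<n}"
  shows "\<exists>i<length F. \<exists>s. beats n L \<alpha> (side F i s) (side F i (\<not> s))"
proof -
  define a where "a = (\<lambda>j\<in>{..<n}. if j \<in> L then \<infinity> else ereal (\<alpha> j))"
  have a: "a j = (if j \<in> L then \<infinity> else ereal (\<alpha> j))" if "j < n" for j
    using that by (simp add: a_def)
  have "ereal x \<in> K" for x using K(1) by blast
  then have "a \<in> {..<n} \<rightarrow>\<^sub>E K" using K(2) by (auto simp: a_def)
  with no_root obtain f g where fg: "(f, g) \<in> set F" "tpoly_eval f a \<noteq> tpoly_eval g a"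
    unfolding system_roots_def by blast
  then obtain i where i: "i < length F" "F ! i = (f, g)" by (auto simp: in_set_conv_nth)
  have tpoly: "is_tpoly Rinf n f" "is_tpoly Rinf n g"
    using sys fg(1) by (auto simp: minplus_system_def)
  have "beats n L \<alpha> g f \<or> beats n L \<alpha> f g"
    using fg(2) beats_if_eval_less[OF tpoly L a] beats_if_eval_less[OF tpoly(2,1) L a]
    by (meson linorder_neqE)
  then have "\<exists>s. beats n L \<alpha> (side F i s) (side F i (\<not> s))"
    using i(2) by (auto simp: side_def ex_bool_eq)
  with i(1) show ?thesis by blast
qed

lemma is_tpoly_Rfin_occurring: "is_tpoly Rfin n f \<Longrightarrow> \<exists>I. I \<in> occurring f"
  unfolding is_tpoly_def occurring_def Rfin_def by force

lemma tpoly_eval_attained: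
  assumes "finite (occurring f)" "tpoly_eval f a \<noteq> \<infinity>"
  obtains I where "I \<in> occurring f" "tpoly_eval f a = f I + monom_eval I a"
proof -
  have ne: "(\<lambda>I. f I + monom_eval I a) ` occurring f \<noteq> {}"
    using assms(2) by (auto simp: tpoly_eval_def top_ereal_def)
  then have "tpoly_eval f a = Min ((\<lambda>I. f I + monom_eval I a) ` occurring f)"
    unfolding tpoly_eval_def using assms(1) by (intro cInf_eq_Min) auto
  then have "tpoly_eval f a \<in> (\<lambda>I. f I + monom_eval I a) ` occurring f" using ne assms(1) by simp
  then show ?thesis using that by auto
qed

section \<open>Certificates exclude roots\<close>

lemma alg_combination_iff:
  "alg_combination n F (f, g) \<longleftrightarrow> (\<exists>K c M p q. K \<ge> 1 \<and>
     (\<forall>t<K. M t \<in> expvecs n \<and> ((p t, q t) \<in> set F \<or> (q t, p t) \<in> set F)) \<and>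
     f = tpoly_sum K (\<lambda>t. monom_mult (c t) (M t) (p t)) \<and>
     g = tpoly_sum K (\<lambda>t. monom_mult (c t) (M t) (q t)))"
  unfolding alg_combination_def by simp

text \<open>Take a monomial \<open>J\<close> of \<open>g\<close> of least value at the root. It
  stems from a monomial of some \<open>q t\<close>; as \<open>p t\<close> has the same value at the
  root, the same row puts into \<open>f\<close> a monomial of no larger value, and \<open>g\<close>
  has a smaller coefficient there: a contradiction. \<open>J0\<close> makes the least value finite,
  without which the last comparison would not be strict.\<close>

lemma combination_excludes_root:
  assumes sys: "minplus_system Rinf n F" and comb: "alg_combination n F (f, g)"
    and greater: "coeffs_greater f g" and root: "a \<in> system_roots Rinf n F"
    and J0: "J0 \<in> occurring g" "monom_eval J0 a \<noteq> \<infinity>"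
  shows False
proof -
  obtain K c M p q where *: "K \<ge> 1 \<and>
     (\<forall>t<K. M t \<in> expvecs n \<and> ((p t, q t) \<in> set F \<or> (q t, p t) \<in> set F)) \<and>
     f = tpoly_sum K (\<lambda>t. monom_mult (c t) (M t) (p t)) \<and>
     g = tpoly_sum K (\<lambda>t. monom_mult (c t) (M t) (q t))"
    using comb unfolding alg_combination_iff by (elim exE) (erule that)
  have K: "K \<ge> 1" "\<And>t. t < K \<Longrightarrow> M t \<in> expvecs n"
      "\<And>t. t < K \<Longrightarrow> (p t, q t) \<in> set F \<or> (q t, p t) \<in> set F"
    and f: "f = tpoly_sum K (\<lambda>t. monom_mult (c t) (M t) (p t))"
    and g: "g = tpoly_sum K (\<lambda>t. monom_mult (c t) (M t) (q t))"
    using * by auto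
  have tpoly: "is_tpoly Rinf n (p t)" "is_tpoly Rinf n (q t)" if "t < K" for t
    using K(3)[OF that] sys by (auto simp: minplus_system_def)
  have eval_eq: "tpoly_eval (p t) a = tpoly_eval (q t) a" if "t < K" for t
    using K(3)[OF that] root by (auto simp: system_roots_def)
  have mon: "monom_eval I a \<noteq> - \<infinity>" if "I \<in> expvecs n" for I
  proof -
    have a_Rinf: "a j \<in> Rinf" if "j < n" for j using root that by (auto simp: system_roots_def)
    define L where "L = {j. j < n \<and> a j = \<infinity>}"
    have "L \<subseteq> {..<n}" by (auto simp: L_def)
    have "a j = (if j \<in> L then \<infinity> else ereal (real_of_ereal (a j)))" if "j < n" for j
      using a_Rinf[OF that] that by (cases "a j") (auto simp: L_def Rinf_def)
    from monom_eval_value[OF that this \<open>L \<subseteq> {..<n}\<close>] show ?thesis by simp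
  qed
  have occ_g: "\<exists>t I. t < K \<and> I \<in> occurring (q t) \<and> J = M t + I \<and> g J = ereal (c t) + q t I"
    if "J \<in> occurring g" for J
  proof -
    obtain t where t: "t < K" "g J = monom_mult (c t) (M t) (q t) J"
      using tpoly_sum_attained[OF K(1)] unfolding g by blast
    with that obtain I where "J = M t + I" "I \<in> occurring (q t)"
      by (auto simp: occurring_def elim: monom_mult_finite)
    with t show ?thesis by auto
  qed
  have "occurring g \<subseteq> (\<Union>t<K. (+) (M t) ` occurring (q t))" using occ_g by blast
  then have fin: "finite (occurring g)"
    by (rule finite_subset) (auto intro!: finite_imageI tpoly_finite_occurring[OF tpoly(2)])
  define h where "h = (\<lambda>J. g J + monom_eval J a)"
  have "h ` occurring g \<noteq> {}" using J0 by blast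
  then have "Min (h ` occurring g) \<in> h ` occurring g" using fin by simp
  then obtain J where J: "J \<in> occurring g" "h J = Min (h ` occurring g)" by auto
  have J_min: "h J \<le> h J'" if "J' \<in> occurring g" for J' using that fin J(2) by simp
  obtain t I where t: "t < K" and I: "I \<in> occurring (q t)" "J = M t + I" "g J = ereal (c t) + q t I"
    using occ_g[OF J(1)] by blast
  have I_exp: "I \<in> expvecs n" using I(1) tpoly_occurring_expvecs[OF tpoly(2)[OF t]] by blast
  have qI: "q t I = ereal (real_of_ereal (q t I))" using tpoly_coeff[OF tpoly(2)[OF t] I(1)] .
  have h_J: "h J = ereal (c t) + q t I + (monom_eval (M t) a + monom_eval I a)"
    using I monom_eval_add[OF K(2)[OF t] I_exp] by (simp add: h_def)
  have "h J0 \<noteq> \<infinity>" using J0 by (auto simp: h_def occurring_def)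
  with J_min[OF J0(1)] have "h J \<noteq> \<infinity>" by auto
  then have fin_M: "monom_eval (M t) a \<noteq> \<infinity>" and fin_I: "monom_eval I a \<noteq> \<infinity>"
    using h_J qI by auto
  have le: "tpoly_eval (p t) a \<le> q t I + monom_eval I a"
    using INF_lower[OF I(1), of "\<lambda>I. q t I + monom_eval I a"]
    by (simp add: eval_eq[OF t] tpoly_eval_def[of "q t"])
  have "q t I + monom_eval I a \<noteq> \<infinity>" using fin_I I(1) by (auto simp: occurring_def)
  with le have "tpoly_eval (p t) a \<noteq> \<infinity>" by auto
  then obtain I' where I': "I' \<in> occurring (p t)" "p t I' + monom_eval I' a \<le> q t I + monom_eval I a"
    using tpoly_eval_attained[OF tpoly_finite_occurring[OF tpoly(1)[OF t]]] le by metis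
  have I'_exp: "I' \<in> expvecs n" using I'(1) tpoly_occurring_expvecs[OF tpoly(1)[OF t]] by blast
  have pI': "p t I' = ereal (real_of_ereal (p t I'))" using tpoly_coeff[OF tpoly(1)[OF t] I'(1)] .
  have "f (M t + I') \<le> monom_mult (c t) (M t) (p t) (M t + I')"
    unfolding f tpoly_sum_def using t by (intro INF_lower) simp
  then have f_le: "f (M t + I') \<le> ereal (c t) + p t I'" by simp
  then have "M t + I' \<in> occurring f" using I'(1) pI' by (cases "p t I'") (auto simp: occurring_def)
  then have "g (M t + I') < f (M t + I')" using greater by (auto simp: coeffs_greater_def)
  with f_le have g_less: "g (M t + I') < ereal (c t) + p t I'" by (rule less_le_trans[rotated])
  then have "M t + I' \<in> occurring g" by (auto simp: occurring_def)
  then have "h J \<le> g (M t + I') + (monom_eval (M t) a + monom_eval I' a)"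
    using J_min monom_eval_add[OF K(2)[OF t] I'_exp] by (fastforce simp: h_def)
  with h_J g_less I'(2) fin_M fin_I mon[OF K(2)[OF t]] mon[OF I_exp] mon[OF I'_exp] qI pI'
  show False
    by (cases "monom_eval (M t) a"; cases "monom_eval I a"; cases "monom_eval I' a";
        cases "q t I"; cases "p t I'"; cases "g (M t + I')") auto
qed

text \<open>
  If no pair were separated at \<open>\<alpha>\<close> below the level \<open>(4 * d) ^ (min n k + 2) * b\<close>, then setting to
  \<open>\<infinity>\<close> the coordinates above one of the thresholds \<open>(4 * d) ^ (s + 1) * b\<close> would give a root:
  a pair that fails for the threshold \<open>s\<close> has its least monomial value within a window around the
  threshold, and these windows are disjoint.
\<close>

lemma separated_pair_below_level:
  fixes b :: real and d :: nat
  assumes sys: "minplus_system Rinf n F" and no_root: "system_roots Rinf n F = {}"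
    and d: "d \<ge> 1" "\<And>i s I. i < length F \<Longrightarrow> I \<in> occurring (side F i s) \<Longrightarrow> expvec_degree I \<le> d"
    and b: "b > 0" "\<And>i s I. i < length F \<Longrightarrow> I \<in> occurring (side F i s) \<Longrightarrow>
      \<bar>real_of_ereal (side F i s I)\<bar> \<le> b"
    and \<alpha>: "\<And>j. j < n \<Longrightarrow> - b \<le> \<alpha> j"
  shows "\<exists>i<length F. (\<exists>s. beats n {} \<alpha> (side F i s) (side F i (\<not> s))) \<and>
    (\<exists>s. \<exists>I\<in>occurring (side F i s).
      mval n (side F i s) \<alpha> I < (4 * real d) ^ (min n (length F) + 2) * b)"
proof (rule ccontr)
  assume contra: "\<not> ?thesis"
  \<comment> \<open>The thresholds \<open>0, ..., S\<close> are \<open>min n (length F) + 2\<close>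
    many, too many to have both distinct pairs among \<open>length F\<close> and distinct sizes of
    \<open>L s\<close> among \<open>0, ..., n\<close>. The last one, \<open>\<tau> S * b\<close>, is
    the level of the statement.\<close>
  define S where "S = min n (length F) + 1"
  define \<tau> where "\<tau> = (\<lambda>s. (4 * real d) ^ (s + 1))"
  define L where "L = (\<lambda>s. {j. j < n \<and> \<tau> s * b \<le> \<alpha> j})"
  have d1: "real d \<ge> 1" using d(1) by simp
  have \<tau>_mono: "\<tau> s \<le> \<tau> s'" if "s \<le> s'" for s s'
    unfolding \<tau>_def using that d1 by (intro power_increasing) auto
  have \<tau>_ge: "4 \<le> \<tau> s" for s
  proof -
    have "\<tau> 0 = 4 * real d" by (simp add: \<tau>_def)
    with \<tau>_mono[of 0 s] d1 show ?thesis by linarith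
  qed
  \<comment> \<open>The windows of different thresholds are disjoint: a factor \<open>4 * d\<close>
    between thresholds outweighs the factor \<open>d\<close> of the upper end and the offsets
    \<open>1\<close> and \<open>d\<close>.\<close>
  have gap: "real d * \<tau> s + 1 < \<tau> s' - real d" if "s < s'" for s s'
  proof -
    have "real d * \<tau> s \<ge> real d * 4" using \<tau>_ge[of s] by (intro mult_left_mono) auto
    moreover have "4 * (real d * \<tau> s) \<le> \<tau> s'" using \<tau>_mono[of "Suc s" s'] that by (simp add: \<tau>_def)
    ultimately show ?thesis using d1 by linarith
  qed
  \<comment> \<open>Adding \<open>b\<close> to all coordinates makes every term nonnegative and
    changes the value by at most \<open>d * b\<close>; one variable above the threshold then
    suffices.\<close>
  have lower: "(\<tau> s - real d) * b \<le> mval n (side F i t) \<alpha> I"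
    if i: "i < length F" and I: "I \<in> occurring (side F i t)" and not_free: "Poly_Mapping.keys I \<inter> L s \<noteq> {}" for i t I s
  proof -
    have I_exp: "I \<in> expvecs n"
      using I tpoly_occurring_expvecs[OF tpoly_side[OF sys i]] by blast
    obtain j where j: "j \<in> Poly_Mapping.keys I" "j < n" "\<tau> s * b \<le> \<alpha> j"
      using not_free by (auto simp: L_def)
    have "\<alpha> j + b \<le> real (Poly_Mapping.lookup I j) * (\<alpha> j + b)"
    proof -
      have "1 \<le> real (Poly_Mapping.lookup I j)" using j(1) by (simp add: in_keys_iff Suc_le_eq)
      with \<alpha>[OF j(2)] show ?thesis using mult_right_mono[of 1 _ "\<alpha> j + b"] by simp
    qed
    also have "\<dots> \<le> (\<Sum>j<n. real (Poly_Mapping.lookup I j) * (\<alpha> j + b))"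
    proof (rule member_le_sum)
      show "0 \<le> real (Poly_Mapping.lookup I j') * (\<alpha> j' + b)" if "j' \<in> {..<n} - {j}" for j'
        using \<alpha>[of j'] that by (intro mult_nonneg_nonneg) auto
    qed (use j in auto)
    also have "\<dots> = (\<Sum>j<n. real (Poly_Mapping.lookup I j) * \<alpha> j) + real (expvec_degree I) * b"
      by (simp add: expvec_degree_eq[OF I_exp] algebra_simps sum.distrib sum_distrib_left)
    finally have "\<alpha> j + b \<le> (\<Sum>j<n. real (Poly_Mapping.lookup I j) * \<alpha> j) + real (expvec_degree I) * b" .
    moreover have "real (expvec_degree I) * b \<le> real d * b"
      using d(2)[OF i I] b(1) by simp
    moreover have "- b \<le> real_of_ereal (side F i t I)" using b(2)[OF i I] by linarith
    ultimately show ?thesis using j(3) by (simp add: mval_def algebra_simps)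
  qed
  have upper: "mval n (side F i t) \<alpha> I \<le> (real d * \<tau> s + 1) * b"
    if i: "i < length F" and I: "I \<in> occurring (side F i t)" and free: "Poly_Mapping.keys I \<inter> L s = {}" for i t I s
  proof -
    have I_exp: "I \<in> expvecs n"
      using I tpoly_occurring_expvecs[OF tpoly_side[OF sys i]] by blast
    have "real (Poly_Mapping.lookup I j) * \<alpha> j \<le> real (Poly_Mapping.lookup I j) * (\<tau> s * b)"
      if "j < n" for j
    proof (cases "j \<in> Poly_Mapping.keys I")
      case True
      with free that have "\<alpha> j \<le> \<tau> s * b" by (auto simp: L_def)
      then show ?thesis by (intro mult_left_mono) auto
    qed (simp add: in_keys_iff)
    then have "(\<Sum>j<n. real (Poly_Mapping.lookup I j) * \<alpha> j)
        \<le> (\<Sum>j<n. real (Poly_Mapping.lookup I j) * (\<tau> s * b))" by (intro sum_mono) simp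
    also have "\<dots> = real (expvec_degree I) * (\<tau> s * b)"
      by (simp add: expvec_degree_eq[OF I_exp] sum_distrib_right)
    also have "\<dots> \<le> real d * (\<tau> s * b)"
      using d(2)[OF i I] b(1) \<tau>_ge[of s] by (intro mult_right_mono) auto
    finally have "(\<Sum>j<n. real (Poly_Mapping.lookup I j) * \<alpha> j) \<le> real d * (\<tau> s * b)" .
    moreover have "real_of_ereal (side F i t I) \<le> b" using b(2)[OF i I] by linarith
    ultimately show ?thesis by (simp add: mval_def algebra_simps)
  qed
  have "\<forall>L. L \<subseteq> {..<n} \<longrightarrow> (\<exists>i<length F. \<exists>t. beats n L \<alpha> (side F i t) (side F i (\<not> t)))"
    using no_root_beats[OF sys no_root range_ereal_subset(2)] by (auto simp: Rinf_def)
  then obtain ix where ix: "\<And>L. L \<subseteq> {..<n} \<Longrightarrow> ix L < length F"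
      "\<And>L. L \<subseteq> {..<n} \<Longrightarrow> \<exists>t. beats n L \<alpha> (side F (ix L) t) (side F (ix L) (\<not> t))" by metis
  have L_sub: "L s \<subseteq> {..<n}" for s by (auto simp: L_def)
  have window_upper: "\<exists>t. \<exists>I\<in>occurring (side F (ix (L s)) t).
      mval n (side F (ix (L s)) t) \<alpha> I \<le> (real d * \<tau> s + 1) * b" for s
  proof -
    obtain t I where "I \<in> occurring (side F (ix (L s)) t)" "Poly_Mapping.keys I \<inter> L s = {}"
      using ix(2)[OF L_sub[of s]] by (auto simp: beats_def)
    with upper[OF ix(1)[OF L_sub[of s]] this] show ?thesis by blast
  qed
  \<comment> \<open>A monomial of smaller value would avoid \<open>L s\<close> and lie below the
    level, so by \<open>contra\<close> the pair is not separated at \<open>\<alpha>\<close>. Its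
    least value is then attained on both sides by monomials avoiding \<open>L s\<close>, so the pair
    is not separated after raising these coordinates either.\<close>
  have window_lower: "(\<tau> s - real d) * b \<le> mval n (side F (ix (L s)) t) \<alpha> I"
    if s: "s \<le> S" and I: "I \<in> occurring (side F (ix (L s)) t)" for s t I
  proof (rule ccontr)
    let ?i = "ix (L s)"
    let ?v = "\<lambda>t I. mval n (side F ?i t) \<alpha> I"
    assume "\<not> (\<tau> s - real d) * b \<le> ?v t I"
    then have low: "?v t I < (\<tau> s - real d) * b" by simp
    have i: "?i < length F" using ix(1)[OF L_sub] .
    have "(\<tau> s - real d) * b \<le> (4 * real d) ^ (min n (length F) + 2) * b"
    proof (rule mult_right_mono)
      have "\<tau> S = (4 * real d) ^ (min n (length F) + 2)" by (simp add: \<tau>_def S_def)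
      with \<tau>_mono[OF s] d1 show "\<tau> s - real d \<le> (4 * real d) ^ (min n (length F) + 2)" by linarith
    qed (use b(1) in simp)
    with low I contra i have no_beats: "\<not> beats n {} \<alpha> (side F ?i t') (side F ?i (\<not> t'))" for t'
      by (meson less_le_trans)
    obtain t' I1 where I1: "I1 \<in> occurring (side F ?i t')"
      and I1_less: "\<And>J. J \<in> occurring (side F ?i (\<not> t')) \<Longrightarrow> Poly_Mapping.keys J \<inter> L s = {} \<Longrightarrow>
        ?v t' I1 < ?v (\<not> t') J"
      using ix(2)[OF L_sub[of s]] by (auto simp: beats_def)
    have dominated: "\<exists>J\<in>occurring (side F ?i (\<not> t')). ?v (\<not> t') J \<le> ?v t' J'"
      if "J' \<in> occurring (side F ?i t')" for J'
      using no_beats[of t'] that by (auto simp: beats_def not_less)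
    have not_t': "?v t' I1 < ?v (\<not> t') J"
      if "J \<in> occurring (side F ?i (\<not> t'))" "?v (\<not> t') J < (\<tau> s - real d) * b" for J
      using I1_less[OF that(1)] lower[OF i that(1), of s] that(2) by linarith
    obtain J1 where J1: "J1 \<in> occurring (side F ?i (\<not> t'))" "?v (\<not> t') J1 \<le> ?v t' I1"
      using dominated[OF I1] by blast
    then have I1_high: "(\<tau> s - real d) * b \<le> ?v t' I1"
      using not_t'[OF J1(1)] by linarith
    show False
    proof (cases "t = t'")
      case True
      then obtain J where "J \<in> occurring (side F ?i (\<not> t'))" "?v (\<not> t') J \<le> ?v t I"
        using dominated I by blast
      with not_t'[of J] low I1_high show False by linarith
    next
      case False
      then have "t = (\<not> t')" by auto
      with not_t'[of I] I low I1_high show False by simp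
    qed
  qed
  have ix_neq: "ix (L s) \<noteq> ix (L s')" if "s < s'" "s' \<le> S" for s s'
  proof
    assume eq: "ix (L s) = ix (L s')"
    obtain t I where "I \<in> occurring (side F (ix (L s)) t)"
        "mval n (side F (ix (L s)) t) \<alpha> I \<le> (real d * \<tau> s + 1) * b"
      using window_upper by blast
    with window_lower[OF that(2), of I t] eq have "(\<tau> s' - real d) * b \<le> (real d * \<tau> s + 1) * b"
      by simp
    with gap[OF that(1)] b(1) show False by (simp add: mult_le_cancel_right)
  qed
  then have inj_ix: "inj_on (\<lambda>s. ix (L s)) {..S}"
    by (metis (no_types, lifting) atMost_iff inj_onI linorder_neqE_nat)
  have "(\<lambda>s. ix (L s)) ` {..S} \<subseteq> {..<length F}" using ix(1)[OF L_sub] by auto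
  then have "card {..S} \<le> card {..<length F}" by (intro card_inj_on_le[OF inj_ix]) auto
  then have S_F: "S < length F" by simp
  \<comment> \<open>The sets \<open>L s\<close> are nested, and \<open>ix\<close> depends on the set
    alone, so different pairs force different sets.\<close>
  have "card (L s') < card (L s)" if "s < s'" "s' \<le> S" for s s'
  proof (rule psubset_card_mono)
    show "finite (L s)" using L_sub finite_subset by blast
    have "\<tau> s * b \<le> \<tau> s' * b" using \<tau>_mono[of s s'] that b(1) by simp
    then have "L s' \<subseteq> L s" by (auto simp: L_def)
    then show "L s' \<subset> L s" using ix_neq[OF that] by auto
  qed
  then have inj_card: "inj_on (\<lambda>s. card (L s)) {..S}"
    by (metis (no_types, lifting) atMost_iff inj_onI linorder_neqE_nat less_irrefl)
  have "card (L s) \<le> n" for s using card_mono[OF _ L_sub[of s]] by simp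
  then have "card {..S} \<le> card {..n}" by (intro card_inj_on_le[OF inj_card]) auto
  then have "S \<le> n" by simp
  with S_F show False by (simp add: S_def min_def split: if_splits)
qed

section \<open>Existence of certificates\<close>

context minplus_lp
begin

lemma block_weight:
  assumes x: "primal (rhs J) x" and i: "i < length F"
  shows "(\<Sum>e\<in>mons i. x e) + (if Slack i \<in> X then x (Slack i) else 0) = real n + 2"
proof -
  let ?B = "mons i \<union> ({Slack i} \<inter> X)"
  have "Block i \<in> rows" using i by (auto simp: rows_def)
  then have "real n + 2 = (\<Sum>e\<in>cols. x e * entry e (Block i))" using x by (simp add: primal_def)
  also have "\<dots> = (\<Sum>e\<in>?B. x e)"
  proof (rule sum.mono_neutral_cong_right)
    show "?B \<subseteq> cols" using i by (auto simp: cols_def)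
    show "\<forall>e\<in>cols - ?B. x e * entry e (Block i) = 0"
    proof
      fix e assume e: "e \<in> cols - ?B"
      then have "e \<in> cols" by simp
      then show "x e * entry e (Block i) = 0" by (cases rule: cols_cases) (use e in auto)
    qed
    show "x e * entry e (Block i) = x e" if "e \<in> ?B" for e
      using that by (auto simp: mons_def)
  qed (rule finite_E)
  also have "\<dots> = (\<Sum>e\<in>mons i. x e) + (\<Sum>e\<in>{Slack i} \<inter> X. x e)"
    using finite_mons[OF i] by (intro sum.union_disjoint) (auto simp: mons_def)
  finally show ?thesis by (auto split: if_splits)
qed

end

text \<open>Without \<open>Slack\<close> columns every pair carries its full weight, so any pair
  separated at the dual point will do.\<close>

lemma certificate_Rfin:
  assumes sys: "minplus_system Rfin n F" and no_root: "system_roots Rfin n F = {}"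
  shows "\<exists>f g. alg_combination n F (f, g) \<and>
    pair_degree (f, g) \<le> (n + 2) * (\<Sum>P\<leftarrow>F. pair_degree P) \<and> coeffs_greater f g"
proof -
  note sys' = minplus_system_Rinf[OF sys]
  interpret minplus_lp n F "{}" 0 0 using sys' by unfold_locales auto
  have "\<exists>I. I \<in> occurring (side F i True)" if "i < length F" for i
    using is_tpoly_Rfin_occurring[OF tpoly_side[OF sys that]] .
  then obtain I where I: "\<And>i. i < length F \<Longrightarrow> I i \<in> occurring (side F i True)" by metis
  \<comment> \<open>\<open>reach\<close> is nonempty: one monomial of each pair takes the whole
    weight \<open>n + 2\<close>.\<close>
  define J where "J = (\<Sum>i<length F. \<Sum>_<n + 2. I i)"
  have lookup_J: "Poly_Mapping.lookup J j = (\<Sum>i<length F. (n + 2) * Poly_Mapping.lookup (I i) j)" for j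
  proof -
    have "Poly_Mapping.lookup J j = (\<Sum>i<length F. \<Sum>_<n + 2. Poly_Mapping.lookup (I i) j)"
      by (simp only: J_def lookup_sum)
    then show ?thesis by simp
  qed
  define x where "x = (\<lambda>e. if e \<in> (\<lambda>i. Mon i True (I i)) ` {..<length F} then real n + 2 else 0)"
  have sum_x: "(\<Sum>e\<in>cols. x e * entry e \<rho>) = (\<Sum>i<length F. (real n + 2) * entry (Mon i True (I i)) \<rho>)" for \<rho>
  proof -
    have "(\<Sum>e\<in>cols. x e * entry e \<rho>) = (\<Sum>e\<in>(\<lambda>i. Mon i True (I i)) ` {..<length F}. (real n + 2) * entry e \<rho>)"
      using I Mon_in_cols finite_E
      by (intro sum.mono_neutral_cong_right) (auto simp: x_def)
    also have "\<dots> = (\<Sum>i<length F. (real n + 2) * entry (Mon i True (I i)) \<rho>)"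
      by (subst sum.reindex) (auto simp: inj_on_def)
    finally show ?thesis .
  qed
  have "J \<in> reach"
    unfolding reach_def
  proof (intro CollectI conjI exI)
    have "Poly_Mapping.lookup (I i) j = 0" if "i < length F" "j \<ge> n" for i j
      using that side_expvecs[OF I[OF that(1)]] by (simp add: lookup_outside_expvecs)
    then have "j < n" if "j \<in> Poly_Mapping.keys J" for j
      using that by (cases "j < n") (simp_all add: lookup_J in_keys_iff)
    then show "J \<in> expvecs n" by (auto simp: expvecs_def)
    have "(\<Sum>e\<in>cols. x e * entry e \<rho>) = rhs J \<rho>" if "\<rho> \<in> rows" for \<rho>
      using that
      by (auto simp: sum_x rows_def lookup_J algebra_simps sum.distrib sum_distrib_left if_distrib[of "\<lambda>z. _ * z"] cong: if_cong)
    then show "primal (rhs J) x" by (auto simp: primal_def x_def)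
  qed
  moreover have "\<exists>i<length F. \<exists>s. (\<Sum>e\<in>mons i. x e) = real n + 2 \<and>
        beats n {} (\<lambda>j. - u (Var j)) (side F i s) (side F i (\<not> s))"
    if "optimal (rhs J) x u" for J x u
  proof -
    have "primal (rhs J) x" using that by (simp add: optimal_def)
    then show ?thesis
      using no_root_beats[OF sys' no_root range_ereal_subset(1), where L = "{}" and \<alpha> = "\<lambda>j. - u (Var j)"]
        block_weight[of J x] by auto
  qed
  ultimately obtain f g where fg: "alg_combination n F (f, g)" "coeffs_greater f g"
      and deg: "real (pair_degree (f, g)) \<le> (real n + 2) * (\<Sum>i<length F. real (pair_degree (F ! i)) + 0)"
    using certificate by blast
  have "(\<Sum>P\<leftarrow>F. pair_degree P) = (\<Sum>i<length F. pair_degree (F ! i))"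
    by (simp add: sum_list_sum_nth atLeast0LessThan)
  then have "real ((n + 2) * (\<Sum>P\<leftarrow>F. pair_degree P)) = (real n + 2) * (\<Sum>i<length F. real (pair_degree (F ! i)) + 0)"
    by (simp add: algebra_simps)
  with deg have "pair_degree (f, g) \<le> (n + 2) * (\<Sum>P\<leftarrow>F. pair_degree P)" by linarith
  with fg show ?thesis by blast
qed

lemma certificate_Rinf:
  assumes sys: "minplus_system Rinf n F" and no_root: "system_roots Rinf n F = {}"
    and d: "d \<ge> 1" "\<And>P. P \<in> set F \<Longrightarrow> pair_degree P \<le> d"
  shows "\<exists>f g. alg_combination n F (f, g) \<and> coeffs_greater f g \<and> g 0 \<noteq> \<infinity> \<and>
    real (pair_degree (f, g)) \<le>
      (real n + 2) * (real (length F) * (real d + (4 * real d) ^ (min n (length F) + 2)))"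
proof -
  define c where "c = (4 * real d) ^ (min n (length F) + 2)"
  define W where "W = (\<lambda>(i, s, I). \<bar>real_of_ereal (side F i s I)\<bar>) `
      (SIGMA i:{..<length F}. SIGMA s:UNIV. occurring (side F i s))"
  have "finite W"
    unfolding W_def using tpoly_finite_occurring[OF tpoly_side[OF sys]]
    by (intro finite_imageI finite_SigmaI) auto
  \<comment> \<open>Inserting \<open>1\<close> keeps the scale positive even if all coefficients are
    \<open>0\<close>.\<close>
  define \<beta> where "\<beta> = Max (insert 1 W)"
  have \<beta>1: "1 \<le> \<beta>" unfolding \<beta>_def using \<open>finite W\<close> by (intro Max_ge) auto
  have \<beta>: "\<bar>real_of_ereal (side F i s I)\<bar> \<le> \<beta>" if "i < length F" "I \<in> occurring (side F i s)" for i s I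
    unfolding \<beta>_def using \<open>finite W\<close> that by (intro Max_ge) (force simp: W_def)+
  define X where "X = Slack ` {..<length F} \<union> Unit ` {..<n} \<union> {Rest}"
  interpret minplus_lp n F X c \<beta>
    using sys by unfold_locales (auto simp: X_def c_def)
  have in_cols: "\<And>i. i < length F \<Longrightarrow> Slack i \<in> cols" "\<And>j. j < n \<Longrightarrow> Unit j \<in> cols" "Rest \<in> cols"
    unfolding cols_def by (simp_all add: X_def)
  have "0 \<in> reach"
    unfolding reach_def
  proof (intro CollectI conjI exI)
    let ?x = "\<lambda>e. if e \<in> Slack ` {..<length F} then real n + 2 else 0"
    have sum_x: "(\<Sum>e\<in>cols. ?x e * entry e \<rho>) = (\<Sum>i<length F. (real n + 2) * entry (Slack i) \<rho>)" for \<rho>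
    proof -
      have "(\<Sum>e\<in>cols. ?x e * entry e \<rho>) = (\<Sum>e\<in>Slack ` {..<length F}. (real n + 2) * entry e \<rho>)"
        using finite_E in_cols by (intro sum.mono_neutral_cong_right) auto
      also have "\<dots> = (\<Sum>i<length F. (real n + 2) * entry (Slack i) \<rho>)"
        by (subst sum.reindex) (auto simp: inj_on_def)
      finally show ?thesis .
    qed
    have "(\<Sum>e\<in>cols. ?x e * entry e \<rho>) = rhs 0 \<rho>" if "\<rho> \<in> rows" for \<rho>
      using that unfolding sum_x by (auto simp: rows_def if_distrib[of "\<lambda>z. _ * z"] cong: if_cong)
    then show "primal (rhs 0) ?x" by (auto simp: primal_def)
  qed (simp add: expvecs_def)
  moreover have "\<exists>i<length F. \<exists>s. (\<Sum>e\<in>mons i. x e) = real n + 2 \<and>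
        beats n {} (\<lambda>j. - u (Var j)) (side F i s) (side F i (\<not> s))"
    if opt: "optimal (rhs J) x u" for J x u
  proof -
    have px: "primal (rhs J) x" and du: "dual u" using opt by (auto simp: optimal_def)
    have du': "(\<Sum>\<rho>\<in>rows. u \<rho> * entry e \<rho>) \<le> cost e" if "e \<in> cols" for e
      using du that by (simp add: dual_def)
    \<comment> \<open>The \<open>Rest\<close> constraint gives \<open>\<beta> \<le> b\<close>, and
      the \<open>Unit j\<close> constraint keeps the dual point above \<open>- b\<close> in
      coordinate \<open>j\<close>.\<close>
    define b where "b = \<beta> - u Tot"
    have "u Tot \<le> 0" using du'[OF in_cols(3)] by (simp only: dual_others cost.simps)
    then have b: "\<beta> \<le> b" by (simp add: b_def)
    have \<alpha>: "- b \<le> - u (Var j)" if "j < n" for j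
      
    proof -
      have "u (Var j) + u Tot \<le> 0"
        using du'[OF in_cols(2)[OF that]] by (simp only: dual_others(2)[OF that] cost.simps)
      with \<beta>1 show ?thesis by (simp add: b_def)
    qed
    have deg: "expvec_degree I \<le> d" if "i < length F" "I \<in> occurring (side F i s)" for i s I
      using expvec_degree_side[OF sys that] d(2)[of "F ! i"] that by (meson le_trans nth_mem)
    have coeff: "\<bar>real_of_ereal (side F i s I)\<bar> \<le> b" if "i < length F" "I \<in> occurring (side F i s)" for i s I
      using \<beta>[OF that] b by linarith
    have "0 < b" using b \<beta>1 by linarith
    have "\<exists>i<length F. (\<exists>s. beats n {} (\<lambda>j. - u (Var j)) (side F i s) (side F i (\<not> s))) \<and>
        (\<exists>s. \<exists>I\<in>occurring (side F i s). mval n (side F i s) (\<lambda>j. - u (Var j)) I < c * b)"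
      unfolding c_def
      by (rule separated_pair_below_level[OF sys no_root d(1) _ \<open>0 < b\<close>]) (fact deg coeff \<alpha>)+
    then obtain i s s' I where i: "i < length F"
      and beats: "beats n {} (\<lambda>j. - u (Var j)) (side F i s) (side F i (\<not> s))"
      and I: "I \<in> occurring (side F i s')" "mval n (side F i s') (\<lambda>j. - u (Var j)) I < c * b"
      by blast
    have "u (Block i) < 0"
      using du'[OF Mon_in_cols[OF i I(1)]] I(2) unfolding dual_mval(1)[OF i] b_def by linarith
    moreover have "u (Block i) = 0" if "0 < x (Slack i)"
    proof -
      have "(\<Sum>\<rho>\<in>rows. u \<rho> * entry (Slack i) \<rho>) = cost (Slack i)"
        using opt in_cols(1)[OF i] that unfolding optimal_iff_slackness[OF px du] by blast
      then show ?thesis by (simp only: dual_others(1)[OF i] cost.simps)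
    qed
    moreover have "0 \<le> x (Slack i)" using px in_cols(1)[OF i] by (auto simp: primal_def)
    ultimately have "x (Slack i) = 0" by fastforce
    then have "(\<Sum>e\<in>mons i. x e) = real n + 2" using block_weight[OF px i] by (simp split: if_splits)
    with i beats show ?thesis by blast
  qed
  ultimately obtain f g where fg: "alg_combination n F (f, g)" "coeffs_greater f g"
      "\<forall>J\<in>reach. g J \<noteq> \<infinity>"
      "real (pair_degree (f, g)) \<le> (real n + 2) * (\<Sum>i<length F. real (pair_degree (F ! i)) + c)"
    using certificate by blast
  have "(\<Sum>i<length F. real (pair_degree (F ! i)) + c) \<le> (\<Sum>i<length F. real d + c)"
    using d(2) by (intro sum_mono) auto
  then have "(real n + 2) * (\<Sum>i<length F. real (pair_degree (F ! i)) + c) \<le>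
      (real n + 2) * (real (length F) * (real d + c))"
    by (intro mult_left_mono) auto
  with fg(4) have "real (pair_degree (f, g)) \<le> (real n + 2) * (real (length F) * (real d + c))" by linarith
  with fg \<open>0 \<in> reach\<close> show ?thesis unfolding c_def by blast
qed

text \<open>For degree \<open>0\<close> the bound of part (ii) is \<open>0\<close>. All polynomials
  are then constants or constantly \<open>\<infinity>\<close>, and a pair separated at the origin is
  itself a certificate.\<close>

lemma certificate_degree_zero:
  assumes sys: "minplus_system Rinf n F" and no_root: "system_roots Rinf n F = {}"
    and d: "\<And>P. P \<in> set F \<Longrightarrow> pair_degree P = 0"
  shows "\<exists>f g. alg_combination n F (f, g) \<and> coeffs_greater f g \<and> g 0 \<noteq> \<infinity> \<and> pair_degree (f, g) = 0"
proof -
  obtain i s where i: "i < length F" and beats: "beats n {} (\<lambda>_. 0) (side F i s) (side F i (\<not> s))"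
    using no_root_beats[OF sys no_root range_ereal_subset(2), where L = "{}" and \<alpha> = "\<lambda>_. 0"] by auto
  define q where "q = side F i s"
  define p where "p = side F i (\<not> s)"
  have zero: "I = 0" if "I \<in> occurring (side F i t)" for t I
  proof (rule poly_mapping_eqI)
    fix j
    have I: "I \<in> expvecs n" using that tpoly_occurring_expvecs[OF tpoly_side[OF sys i]] by blast
    have "expvec_degree I = 0" using expvec_degree_side[OF sys i that] d[of "F ! i"] i by simp
    then show "Poly_Mapping.lookup I j = Poly_Mapping.lookup 0 j"
      using lookup_outside_expvecs[OF I, of j] by (cases "j < n") (auto simp: expvec_degree_eq[OF I])
  qed
  have occ: "occurring q \<subseteq> {0}" "occurring p \<subseteq> {0}" using zero by (auto simp: p_def q_def)
  have tpoly: "is_tpoly Rinf n q" "is_tpoly Rinf n p" using tpoly_side[OF sys i] by (auto simp: p_def q_def)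
  have q0: "0 \<in> occurring q" using beats occ by (auto simp: beats_def q_def)
  have mm: "monom_mult 0 0 h = h" for h by (auto simp: monom_mult_def fun_eq_iff zero_ereal_def[symmetric])
  have "alg_combination n F (p, q)"
    unfolding alg_combination_def
    by (rule exI[of _ 1], rule exI[of _ "\<lambda>_. 0"], rule exI[of _ "\<lambda>_. 0"],
        rule exI[of _ "\<lambda>_. p"], rule exI[of _ "\<lambda>_. q"])
       (use side_in_system[OF i, of s] in \<open>auto simp: p_def q_def mm tpoly_sum_def expvecs_def lessThan_Suc\<close>)
  moreover have "p 0 > q 0"
  proof (cases "0 \<in> occurring p")
    case True
    then have "real_of_ereal (q 0) < real_of_ereal (p 0)"
      using beats occ by (auto simp: beats_def mval_def p_def q_def)
    then show ?thesis using tpoly_coeff[OF tpoly(1) q0] tpoly_coeff[OF tpoly(2) True] by (metis less_ereal.simps(1))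
  next
    case False
    then show ?thesis using q0 by (auto simp: occurring_def)
  qed
  then have "coeffs_greater p q" using occ by (auto simp: coeffs_greater_def)
  moreover have "tpoly_degree h = 0" if "occurring h \<subseteq> {0}" for h
  proof -
    have "insert 0 (expvec_degree ` occurring h) = {0}" using that by (auto simp: expvec_degree_def)
    then show ?thesis by (simp only: tpoly_degree_def Max_singleton)
  qed
  then have "pair_degree (p, q) = 0" using occ by (simp add: pair_degree_def)
  moreover have "q 0 \<noteq> \<infinity>" using q0 by (simp add: occurring_def)
  ultimately show ?thesis by blast
qed

text \<open>The factor \<open>16 * z ^ 2\<close> comes from splitting
  \<open>(4 * d) ^ (m + 2)\<close> into \<open>16 * d ^ 2\<close> and
  \<open>(4 * d) ^ m\<close>.\<close>

lemma polynomial3_bound: "polynomial3 (\<lambda>x y z. (x + 2) * y * (z + 16 * z ^ 2))"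
proof -
  define C :: "nat \<Rightarrow> nat \<Rightarrow> nat \<Rightarrow> real" where
    "C = (\<lambda>a b c. (if a = 0 then 2 else if a = 1 then 1 else 0) * (if b = 1 then 1 else 0) *
                  (if c = 1 then 1 else if c = 2 then 16 else 0))"
  have "(x + 2) * y * (z + 16 * z ^ 2) = (\<Sum>a\<le>2. \<Sum>b\<le>2. \<Sum>c\<le>2. C a b c * x ^ a * y ^ b * z ^ c)"
    for x y z :: real
    by (simp add: C_def numeral_2_eq_2 algebra_simps)
  then show ?thesis unfolding polynomial3_def by blast
qed

theorem theorem9:
  "(\<forall>(n::nat) F. minplus_system Rfin n F \<longrightarrow>
      (system_roots Rfin n F = {} \<longleftrightarrow>
        (\<exists>f g. alg_combination n F (f, g) \<and>
           pair_degree (f, g) \<le> (n + 2) * (\<Sum>P\<leftarrow>F. pair_degree P) \<and>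
           coeffs_greater f g)))
   \<and>
   (\<exists>p. polynomial3 p \<and>
      (\<forall>(n::nat) F k d. minplus_system Rinf n F \<longrightarrow> k = length F \<longrightarrow>
        d = Max (insert 0 (pair_degree ` set F)) \<longrightarrow>
        (system_roots Rinf n F = {} \<longleftrightarrow>
          (\<exists>f g. alg_combination n F (f, g) \<and>
             real (pair_degree (f, g)) \<le>
               p (real n) (real k) (real d) * (4 * real d) ^ min n k \<and>
             coeffs_greater f g \<and> g 0 \<noteq> \<infinity>))))"
proof (intro conjI allI impI exI[of _ "\<lambda>x y z. (x + 2) * y * (z + 16 * z ^ 2)"] polynomial3_bound)
  fix n :: nat and F assume sys: "minplus_system Rfin n F"
  show "system_roots Rfin n F = {} \<longleftrightarrow>
        (\<exists>f g. alg_combination n F (f, g) \<and>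
           pair_degree (f, g) \<le> (n + 2) * (\<Sum>P\<leftarrow>F. pair_degree P) \<and> coeffs_greater f g)"
    (is "_ \<longleftrightarrow> ?C")
  proof
    assume ?C
    then obtain f g where comb: "alg_combination n F (f, g)" and greater: "coeffs_greater f g" by blast
    obtain K c M p q where *: "K \<ge> 1 \<and>
       (\<forall>t<K. M t \<in> expvecs n \<and> ((p t, q t) \<in> set F \<or> (q t, p t) \<in> set F)) \<and>
       f = tpoly_sum K (\<lambda>t. monom_mult (c t) (M t) (p t)) \<and>
       g = tpoly_sum K (\<lambda>t. monom_mult (c t) (M t) (q t))"
      using comb unfolding alg_combination_iff by (elim exE) (erule that)
    have K: "K \<ge> 1" "\<And>t. t < K \<Longrightarrow> M t \<in> expvecs n"
        "\<And>t. t < K \<Longrightarrow> (p t, q t) \<in> set F \<or> (q t, p t) \<in> set F"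
      and g: "g = tpoly_sum K (\<lambda>t. monom_mult (c t) (M t) (q t))"
      using * by auto
    \<comment> \<open>Over the reals the first row already puts a monomial into \<open>g\<close>,
      and at a finite point its value is finite.\<close>
    have q0: "is_tpoly Rfin n (q 0)" using sys K(1) K(3)[of 0] by (auto simp: minplus_system_def)
    then obtain I where I: "q 0 I \<noteq> \<infinity>" using is_tpoly_Rfin_occurring by (auto simp: occurring_def)
    then have "I \<in> expvecs n"
      using tpoly_occurring_expvecs[OF is_tpoly_mono[OF q0]] by (auto simp: occurring_def Rfin_def Rinf_def)
    then have exp: "M 0 + I \<in> expvecs n" using K(1,2) by (simp add: expvecs_add_iff)
    have "g (M 0 + I) \<le> monom_mult (c 0) (M 0) (q 0) (M 0 + I)"
      unfolding g tpoly_sum_def using K by (intro INF_lower) simp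
    with I have occ: "M 0 + I \<in> occurring g" by (auto simp: occurring_def)
    show "system_roots Rfin n F = {}"
    proof (rule ccontr)
      assume "system_roots Rfin n F \<noteq> {}"
      then obtain a where a: "a \<in> system_roots Rfin n F" by blast
      have fin: "a j = ereal (real_of_ereal (a j))" if "j < n" for j
      proof -
        have "a j \<in> Rfin" using a that by (auto simp: system_roots_def)
        then show ?thesis by (cases "a j") (auto simp: Rfin_def)
      qed
      have "Rfin \<subseteq> Rinf" unfolding Rfin_def Rinf_def by blast
      then have a': "a \<in> system_roots Rinf n F" using a unfolding system_roots_def by (auto simp: PiE_iff)
      have "monom_eval (M 0 + I) a \<noteq> \<infinity>"
        using monom_eval_value[OF exp, of a "{}" "\<lambda>j. real_of_ereal (a j)"] fin by auto
      from combination_excludes_root[OF minplus_system_Rinf[OF sys] comb greater a' occ this]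
      show False .
    qed
  qed (use certificate_Rfin[OF sys] in blast)
next
  fix n :: nat and F :: "(tpoly \<times> tpoly) list" and k d :: nat
  assume sys: "minplus_system Rinf n F" and k: "k = length F"
    and d: "d = Max (insert 0 (pair_degree ` set F))"
  have deg: "pair_degree P \<le> d" if "P \<in> set F" for P using that by (simp add: d)
  show "system_roots Rinf n F = {} \<longleftrightarrow>
        (\<exists>f g. alg_combination n F (f, g) \<and> real (pair_degree (f, g)) \<le>
           (real n + 2) * real k * (real d + 16 * (real d)\<^sup>2) * (4 * real d) ^ min n k \<and>
           coeffs_greater f g \<and> g 0 \<noteq> \<infinity>)" (is "_ \<longleftrightarrow> ?C")
  proof
    assume no_root: "system_roots Rinf n F = {}"
    show ?C
    proof (cases "d = 0")
      case True
      then show ?thesis using certificate_degree_zero[OF sys no_root] deg by fastforce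
    next
      case False
      then have d1: "d \<ge> 1" by simp
      let ?q = "(4 * real d) ^ min n k"
      have "real d * 1 \<le> real d * ?q" using d1 by (intro mult_left_mono one_le_power) auto
      then have "real d + (4 * real d) ^ (min n k + 2) \<le> (real d + 16 * (real d)\<^sup>2) * ?q"
        by (simp add: algebra_simps power2_eq_square)
      then have "(real n + 2) * (real k * (real d + (4 * real d) ^ (min n k + 2))) \<le>
          (real n + 2) * (real k * ((real d + 16 * (real d)\<^sup>2) * ?q))"
        by (intro mult_left_mono) auto
      also have "\<dots> = (real n + 2) * real k * (real d + 16 * (real d)\<^sup>2) * ?q" by (simp only: mult.assoc)
      finally have bound: "(real n + 2) * (real k * (real d + (4 * real d) ^ (min n k + 2))) \<le>
          (real n + 2) * real k * (real d + 16 * (real d)\<^sup>2) * ?q" .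
      obtain f g where "alg_combination n F (f, g)" "coeffs_greater f g" "g 0 \<noteq> \<infinity>"
        "real (pair_degree (f, g)) \<le> (real n + 2) * (real k * (real d + (4 * real d) ^ (min n k + 2)))"
        using certificate_Rinf[OF sys no_root d1] deg unfolding k by blast
      with bound show ?thesis by (meson order_trans)
    qed
  next
    assume ?C
    then obtain f g where fg: "alg_combination n F (f, g)" "coeffs_greater f g" "g 0 \<noteq> \<infinity>" by blast
    \<comment> \<open>The constant monomial is finite at every point, even where all coordinates are
      \<open>\<infinity>\<close>; this is what the finite constant term of \<open>g\<close>
      provides.\<close>
    have "0 \<in> occurring g" using fg(3) by (simp add: occurring_def)
    moreover have "monom_eval 0 a \<noteq> \<infinity>" for a by (simp add: monom_eval_def)
    ultimately show "system_roots Rinf n F = {}"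
      using combination_excludes_root[OF sys fg(1,2)] by blast
  qed
qed

end
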